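(* Let $G$ be a countable infinite discrete sofic group with a fixed sofic approximation sequence $\Sigma=\{\sigma_i:G\to\mathrm{Sym}(d_i)\}_{i\in\mathbb{N}}$, acting continuously on a compact metric space $(X,\rho)$. If $\mathcal{U}$ is an open cover of $X$ and $f\in C(X)$, then $$P(\mathcal{U},f)=P^*(\mathcal{U},f)=\max_{\mu\in M(X,G)}\{h_\mu(\mathcal{U})+\mu(f)\}.$$
   Context: Notation. $\mathcal{F}(Z)$ is the set of non-empty finite subsets of $Z$; $[d]=\{1,\dots,d\}$; $\mathrm{Sym}(d)$ is the permutation group of $[d]$. $C(X)$ is the set of real-valued continuous functions on $X$; $M(X)$ is the set of Borel probability measures on $X$, $M(X,G)$ the subset of $G$-invariant ones; $\mu(f)=\int f\,d\mu$. The action is written $(s,x)\mapsto sx$, and $\alpha_s:X\to X$ denotes $x\mapsto sx$. Sofic approximation sequence: maps (not necessarily homomorphisms) $\sigma_i:G\to\mathrm{Sym}(d_i)$, $g\mapsto\sigma_{i,g}$, with $d_i\to\infty$, such that $\lim_i\frac1{d_i}|\{a\in[d_i]:\sigma_{i,st}(a)=\sigma_{i,s}\sigma_{i,t}(a)\}|=1$ for all $s,t\in G$ and $\lim_i\frac1{d_i}|\{a\in[d_i]:\sigma_{i,s}(a)\ne\sigma_{i,t}(a)\}|=1$ for all $s\neq t$ in $G$. $G$ is sofic if such a sequence exists. Covers. A cover of a subset $Y$ of a space $Z$ is a family of subsets of $Z$ whose union contains $Y$; it is open if its members are open in $Z$. $\beta\succcurlyeq\mathcal{V}$ ($\beta$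 is finer than $\mathcal{V}$) means each element of $\beta$ is contained in some element of $\mathcal{V}$. For an open cover $\mathcal{U}$ of $X$, $\mathcal{U}^d=\{U_1\times\cdots\times U_d:U_j\in\mathcal{U}\}$, a cover of $X^d$. $N(\mathcal{V},Y)$ is the minimal cardinality of a subfamily of $\mathcal{V}$ covering $Y$, with $N(\mathcal{V},\emptyset)=0$. Maps $\varphi:[d]\to X$ are identified with points of $X^d$. For $F\in\mathcal{F}(G)$, $\delta>0$, $\sigma:G\to\mathrm{Sym}(d)$, set $$Map(F,\delta,\sigma)=\Big\{\varphi:[d]\to X:\ \max_{s\in F}\rho_2(\varphi\circ\sigma_s,\alpha_s\circ\varphi)<\delta\Big\},\quad \rho_2(\varphi,\psi)=\Big(\tfrac1d\sum_{a=1}^d\rho(\varphi(a),\psi(a))^2\Big)^{1/2}.$$ For $L\in\mathcal{F}(C(X))$ and $\mu\in M(X)$, $$Map_\mu(L,F,\delta,\sigma)=\Big\{\varphi\in Map(F,\delta,\sigma):\max_{g\in L}\Big|\tfrac1d\sum_{j=1}^d g(\varphi(j))-\mu(g)\Big|<\delta\Big\}.$$ Local sofic pressure. $N(\sigma,F,\delta,\mathcal{U},f)=\inf_\beta\sum_{U\in\beta}\sup_{\varphi\in U\cap Map(F,\delta,\sigma)}\exp\big(\sum_{a=1}^d f(\varphi(a))\big)$, the infimum over all covers $\beta$ of $Map(F,\delta,\sigma)$ (by subsets of $X^d$) with $\beta\succcurlyeq\mathcal{U}^d$; $P(F,\delta,\mathcal{U},f)=\limsup_{i\to\infty}\frac1{d_i}\log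 N(\sigma_i,F,\delta,\mathcal{U},f)$; $P(\mathcal{U},f)=\inf_{F\in\mathcal{F}(G)}\inf_{\delta>0}P(F,\delta,\mathcal{U},f)$. $N^*(\sigma,F,\delta,\mathcal{U},f)$, $P^*(F,\delta,\mathcal{U},f)$ and $P^*(\mathcal{U},f)$ are defined in exactly the same way, except that the infimum over $\beta$ is restricted to covers of $Map(F,\delta,\sigma)$ by open subsets of $X^d$ with $\beta\succcurlyeq\mathcal{U}^d$. Local measure entropy. $h_\mu(L,F,\delta,\mathcal{U})=\limsup_{i\to\infty}\frac1{d_i}\log N(\mathcal{U}^{d_i},Map_\mu(L,F,\delta,\sigma_i))$ and $h_\mu(\mathcal{U})=\inf_{L\in\mathcal{F}(C(X))}\inf_{F\in\mathcal{F}(G)}\inf_{\delta>0}h_\mu(L,F,\delta,\mathcal{U})$. Conventions: $\log 0=-\infty$; the supremum of exponentials over the empty set is $0$; all quantities are extended-real valued; the maximum over an empty set (if $M(X,G)=\emptyset$) is $-\infty$. *)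

theory Defs
  imports
    "HOL-Analysis.Analysis"
    "HOL-Probability.Probability_Measure"
    "HOL-Algebra.Group_Action"
begin

text \<open>
  The compact metric space is a (possibly empty) compact subset \<open>X\<close> of a type of class
  \<open>metric_space\<close>, with the metric \<open>dist\<close>. The set \<open>[d]\<close> is \<open>{1..d}\<close>, and \<open>X^d\<close> is the set of
  extensional functions \<open>{1..d} \<rightarrow>\<^sub>E X\<close>, so that its points are the maps \<open>[d] \<rightarrow> X\<close>. An element of
  \<open>C(X)\<close> is a function that is continuous on \<open>X\<close>; its values outside \<open>X\<close> play no role.
\<close>

definition FinNE :: "'a set \<Rightarrow> 'a set set" where
  "FinNE Z = {F. F \<subseteq> Z \<and> finite F \<and> F \<noteq> {}}"

definition CX :: "'x::metric_space set \<Rightarrow> ('x \<Rightarrow> real) set" where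
  "CX X = {f. continuous_on X f}"

definition sofic_approximation ::
  "('g, 'm) monoid_scheme \<Rightarrow> (nat \<Rightarrow> nat) \<Rightarrow> (nat \<Rightarrow> 'g \<Rightarrow> nat \<Rightarrow> nat) \<Rightarrow> bool" where
  "sofic_approximation G d \<sigma> \<longleftrightarrow>
     (\<forall>i. \<forall>s\<in>carrier G. \<sigma> i s permutes {1..d i}) \<and>
     filterlim d at_top sequentially \<and>
     (\<forall>s\<in>carrier G. \<forall>t\<in>carrier G.
        (\<lambda>i. real (card {a \<in> {1..d i}. \<sigma> i (s \<otimes>\<^bsub>G\<^esub> t) a = \<sigma> i s (\<sigma> i t a)}) / real (d i))
          \<longlonglongrightarrow> 1) \<and>
     (\<forall>s\<in>carrier G. \<forall>t\<in>carrier G. s \<noteq> t \<longrightarrow>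
        (\<lambda>i. real (card {a \<in> {1..d i}. \<sigma> i s a \<noteq> \<sigma> i t a}) / real (d i)) \<longlonglongrightarrow> 1)"

text \<open>The library's \<open>group_action\<close> takes the bijections \<open>\<alpha> s\<close> to be extensional on \<open>X\<close>.\<close>

definition continuous_action ::
  "('g, 'm) monoid_scheme \<Rightarrow> 'x::metric_space set \<Rightarrow> ('g \<Rightarrow> 'x \<Rightarrow> 'x) \<Rightarrow> bool" where
  "continuous_action G X \<alpha> \<longleftrightarrow>
     group_action G X \<alpha> \<and>
     continuous_map (prod_topology (discrete_topology (carrier G)) (top_of_set X)) (top_of_set X)
       (\<lambda>(s, x). \<alpha> s x)"

definition prob_measures :: "'x::metric_space set \<Rightarrow> 'x measure set" where
  "prob_measures X = {\<mu>. prob_space \<mu> \<and> sets \<mu> = sets (restrict_space borel X)}"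

definition invariant_measures ::
  "('g, 'm) monoid_scheme \<Rightarrow> 'x::metric_space set \<Rightarrow> ('g \<Rightarrow> 'x \<Rightarrow> 'x) \<Rightarrow> 'x measure set" where
  "invariant_measures G X \<alpha> =
     {\<mu> \<in> prob_measures X. \<forall>s\<in>carrier G. distr \<mu> \<mu> (\<alpha> s) = \<mu>}"

definition open_cover :: "'x::metric_space set \<Rightarrow> 'x set set \<Rightarrow> bool" where
  "open_cover X \<U> \<longleftrightarrow> (\<forall>U\<in>\<U>. openin (top_of_set X) U) \<and> X \<subseteq> \<Union>\<U>"

definition finer :: "'a set set \<Rightarrow> 'a set set \<Rightarrow> bool" where
  "finer \<beta> \<V> \<longleftrightarrow> (\<forall>B\<in>\<beta>. \<exists>V\<in>\<V>. B \<subseteq> V)"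

definition pow_space :: "'x set \<Rightarrow> nat \<Rightarrow> (nat \<Rightarrow> 'x) set" where
  "pow_space X d = {1..d} \<rightarrow>\<^sub>E X"

definition pow_topology :: "'x::metric_space set \<Rightarrow> nat \<Rightarrow> (nat \<Rightarrow> 'x) topology" where
  "pow_topology X d = product_topology (\<lambda>_. top_of_set X) {1..d}"

definition pow_cover :: "'x set set \<Rightarrow> nat \<Rightarrow> (nat \<Rightarrow> 'x) set set" where
  "pow_cover \<U> d = {PiE {1..d} W | W. \<forall>j\<in>{1..d}. W j \<in> \<U>}"

text \<open>The value is \<open>\<infinity>\<close> if no finite subfamily of \<open>\<V>\<close> covers \<open>Y\<close>.\<close>

definition cover_number :: "'a set set \<Rightarrow> 'a set \<Rightarrow> ennreal" where
  "cover_number \<V> Y = (INF \<W>\<in>{\<W>. \<W> \<subseteq> \<V> \<and> finite \<W> \<and> Y \<subseteq> \<Union>\<W>}. of_nat (card \<W>))"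

definition elog :: "ennreal \<Rightarrow> ereal" where
  "elog x = (if x = 0 then -\<infinity> else if x = \<infinity> then \<infinity> else ereal (ln (enn2real x)))"

definition rho2 :: "nat \<Rightarrow> (nat \<Rightarrow> 'x::metric_space) \<Rightarrow> (nat \<Rightarrow> 'x) \<Rightarrow> real" where
  "rho2 d \<phi> \<psi> = sqrt (1 / real d * (\<Sum>a=1..d. (dist (\<phi> a) (\<psi> a))\<^sup>2))"

definition sofic_Map ::
  "'x::metric_space set \<Rightarrow> ('g \<Rightarrow> 'x \<Rightarrow> 'x) \<Rightarrow> nat \<Rightarrow> 'g set \<Rightarrow> real \<Rightarrow> ('g \<Rightarrow> nat \<Rightarrow> nat)
     \<Rightarrow> (nat \<Rightarrow> 'x) set" where
  "sofic_Map X \<alpha> d F \<delta> \<sigma> =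
     {\<phi> \<in> pow_space X d. (MAX s\<in>F. rho2 d (\<phi> \<circ> \<sigma> s) (\<alpha> s \<circ> \<phi>)) < \<delta>}"

definition sofic_Map_measure ::
  "'x::metric_space set \<Rightarrow> ('g \<Rightarrow> 'x \<Rightarrow> 'x) \<Rightarrow> 'x measure \<Rightarrow> nat \<Rightarrow> ('x \<Rightarrow> real) set \<Rightarrow> 'g set \<Rightarrow> real
     \<Rightarrow> ('g \<Rightarrow> nat \<Rightarrow> nat) \<Rightarrow> (nat \<Rightarrow> 'x) set" where
  "sofic_Map_measure X \<alpha> \<mu> d L F \<delta> \<sigma> =
     {\<phi> \<in> sofic_Map X \<alpha> d F \<delta> \<sigma>.
        (MAX g\<in>L. \<bar>1 / real d * (\<Sum>j=1..d. g (\<phi> j)) - (\<integral>x. g x \<partial>\<mu>)\<bar>) < \<delta>}"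

text \<open>
  In the next three definitions \<open>\<A> d\<close> is the collection of subsets of \<open>X^d\<close> from which the members
  of the covers \<open>\<beta>\<close> may be taken: all subsets for \<open>N\<close> and \<open>P\<close>, the open ones for \<open>N\<^sup>*\<close> and \<open>P\<^sup>*\<close>.
  The covers may be infinite, so the sum over \<open>\<beta>\<close> is an unordered sum in \<open>[0, \<infinity>]\<close>. The supremum
  over the empty set in \<open>ennreal\<close> is \<open>0\<close>.
\<close>

definition gen_N ::
  "(nat \<Rightarrow> (nat \<Rightarrow> 'x) set set) \<Rightarrow> 'x::metric_space set \<Rightarrow> ('g \<Rightarrow> 'x \<Rightarrow> 'x) \<Rightarrow> nat
     \<Rightarrow> ('g \<Rightarrow> nat \<Rightarrow> nat) \<Rightarrow> 'g set \<Rightarrow> real \<Rightarrow> 'x set set \<Rightarrow> ('x \<Rightarrow> real) \<Rightarrow> ennreal" where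
  "gen_N \<A> X \<alpha> d \<sigma> F \<delta> \<U> f =
     (INF \<beta>\<in>{\<beta>. \<beta> \<subseteq> \<A> d \<and> sofic_Map X \<alpha> d F \<delta> \<sigma> \<subseteq> \<Union>\<beta> \<and> finer \<beta> (pow_cover \<U> d)}.
        \<Sum>\<^sub>\<infinity>U\<in>\<beta>. (SUP \<phi>\<in>U \<inter> sofic_Map X \<alpha> d F \<delta> \<sigma>. ennreal (exp (\<Sum>a=1..d. f (\<phi> a)))))"

definition gen_P_at ::
  "(nat \<Rightarrow> (nat \<Rightarrow> 'x) set set) \<Rightarrow> 'x::metric_space set \<Rightarrow> ('g \<Rightarrow> 'x \<Rightarrow> 'x) \<Rightarrow> (nat \<Rightarrow> nat)
     \<Rightarrow> (nat \<Rightarrow> 'g \<Rightarrow> nat \<Rightarrow> nat) \<Rightarrow> 'g set \<Rightarrow> real \<Rightarrow> 'x set set \<Rightarrow> ('x \<Rightarrow> real) \<Rightarrow> ereal" where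
  "gen_P_at \<A> X \<alpha> d \<sigma> F \<delta> \<U> f =
     limsup (\<lambda>i. ereal (1 / real (d i)) * elog (gen_N \<A> X \<alpha> (d i) (\<sigma> i) F \<delta> \<U> f))"

definition gen_P ::
  "(nat \<Rightarrow> (nat \<Rightarrow> 'x) set set) \<Rightarrow> ('g, 'm) monoid_scheme \<Rightarrow> 'x::metric_space set
     \<Rightarrow> ('g \<Rightarrow> 'x \<Rightarrow> 'x) \<Rightarrow> (nat \<Rightarrow> nat) \<Rightarrow> (nat \<Rightarrow> 'g \<Rightarrow> nat \<Rightarrow> nat)
     \<Rightarrow> 'x set set \<Rightarrow> ('x \<Rightarrow> real) \<Rightarrow> ereal" where
  "gen_P \<A> G X \<alpha> d \<sigma> \<U> f =
     (INF F\<in>FinNE (carrier G). INF \<delta>\<in>{0<..}. gen_P_at \<A> X \<alpha> d \<sigma> F \<delta> \<U> f)"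

definition sofic_pressure ::
  "('g, 'm) monoid_scheme \<Rightarrow> 'x::metric_space set \<Rightarrow> ('g \<Rightarrow> 'x \<Rightarrow> 'x) \<Rightarrow> (nat \<Rightarrow> nat)
     \<Rightarrow> (nat \<Rightarrow> 'g \<Rightarrow> nat \<Rightarrow> nat) \<Rightarrow> 'x set set \<Rightarrow> ('x \<Rightarrow> real) \<Rightarrow> ereal" where
  "sofic_pressure G X \<alpha> d \<sigma> \<U> f = gen_P (\<lambda>n. Pow (pow_space X n)) G X \<alpha> d \<sigma> \<U> f"

definition sofic_pressure_star ::
  "('g, 'm) monoid_scheme \<Rightarrow> 'x::metric_space set \<Rightarrow> ('g \<Rightarrow> 'x \<Rightarrow> 'x) \<Rightarrow> (nat \<Rightarrow> nat)
     \<Rightarrow> (nat \<Rightarrow> 'g \<Rightarrow> nat \<Rightarrow> nat) \<Rightarrow> 'x set set \<Rightarrow> ('x \<Rightarrow> real) \<Rightarrow> ereal" where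
  "sofic_pressure_star G X \<alpha> d \<sigma> \<U> f =
     gen_P (\<lambda>n. {V. openin (pow_topology X n) V}) G X \<alpha> d \<sigma> \<U> f"

definition measure_entropy_at ::
  "'x::metric_space set \<Rightarrow> ('g \<Rightarrow> 'x \<Rightarrow> 'x) \<Rightarrow> (nat \<Rightarrow> nat) \<Rightarrow> (nat \<Rightarrow> 'g \<Rightarrow> nat \<Rightarrow> nat)
     \<Rightarrow> 'x measure \<Rightarrow> ('x \<Rightarrow> real) set \<Rightarrow> 'g set \<Rightarrow> real \<Rightarrow> 'x set set \<Rightarrow> ereal" where
  "measure_entropy_at X \<alpha> d \<sigma> \<mu> L F \<delta> \<U> =
     limsup (\<lambda>i. ereal (1 / real (d i)) *
       elog (cover_number (pow_cover \<U> (d i)) (sofic_Map_measure X \<alpha> \<mu> (d i) L F \<delta> (\<sigma> i))))"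

definition measure_entropy ::
  "('g, 'm) monoid_scheme \<Rightarrow> 'x::metric_space set \<Rightarrow> ('g \<Rightarrow> 'x \<Rightarrow> 'x) \<Rightarrow> (nat \<Rightarrow> nat)
     \<Rightarrow> (nat \<Rightarrow> 'g \<Rightarrow> nat \<Rightarrow> nat) \<Rightarrow> 'x measure \<Rightarrow> 'x set set \<Rightarrow> ereal" where
  "measure_entropy G X \<alpha> d \<sigma> \<mu> \<U> =
     (INF L\<in>FinNE (CX X). INF F\<in>FinNE (carrier G). INF \<delta>\<in>{0<..}.
        measure_entropy_at X \<alpha> d \<sigma> \<mu> L F \<delta> \<U>)"

text \<open>The maximum is attained, unless the set is empty; the maximum of the empty set is \<open>-\<infinity>\<close>.\<close>

definition is_maximum :: "ereal set \<Rightarrow> ereal \<Rightarrow> bool" where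
  "is_maximum A m \<longleftrightarrow> (if A = {} then m = -\<infinity> else m \<in> A \<and> (\<forall>a\<in>A. a \<le> m))"

end

theory Submission
  imports Defs
begin

text \<open>
  Two of the three inequalities are elementary. Open covers are covers, so \<open>P \<le> P\<^sup>*\<close>. If \<open>\<phi>\<close> is
  counted by \<open>h\<^sub>\<mu>\<close> with \<open>L = {f}\<close>, then \<open>exp (\<Sum> f (\<phi> a))\<close> is at least
  \<open>exp (d (\<mu>(f) - \<epsilon>))\<close>, and every member of a cover finer than \<open>\<U>\<^sup>d\<close> lies in a member of \<open>\<U>\<^sup>d\<close>;
  so \<open>h\<^sub>\<mu>(\<U>) + \<mu>(f) \<le> P\<close>.

  Suppose \<open>h\<^sub>\<mu>(\<U>) + \<mu>(f) < P\<^sup>*\<close> for every invariant \<open>\<mu>\<close>. Then each probability measure \<open>\<mu>\<close> has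
  a weak* neighbourhood, given by some \<open>(L, F, \<delta>)\<close> with \<open>f \<in> L\<close>, whose maps contribute strictly
  less than \<open>P\<^sup>*\<close>: for invariant \<open>\<mu>\<close> by assumption, for the others because there are no such maps
  at all. Finitely many of the neighbourhoods suffice, since the states of \<open>C(X)\<close> are weak* compact
  and, by the Riesz representation theorem, are measures. The covers that realise
  \<open>N(\<U>\<^sup>d, Map\<^sub>\<mu>(L, F, \<delta>))\<close> consist of open sets; intersected with the open sets
  \<open>{\<phi>. 1/d \<Sum> f (\<phi> a) < \<mu>(f) + \<delta>}\<close> and put together they bound \<open>N\<^sup>*\<close>, and \<open>P\<^sup>* < P\<^sup>*\<close> follows.
\<close>

section \<open>Measures and states on a compact metric space\<close>

text \<open>The weak* topology is here the product topology on the function type. Fixing the value 0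
  off \<open>CX X\<close> leaves no unbounded coordinate, so that the set is compact. Elements of
  \<open>CX X\<close> that agree on \<open>X\<close> get the same value, by positivity applied to
  their difference and its negative.\<close>

definition states :: "'x::metric_space set \<Rightarrow> (('x \<Rightarrow> real) \<Rightarrow> real) set" where
  "states X = {\<Lambda>. (\<forall>g. g \<notin> CX X \<longrightarrow> \<Lambda> g = 0) \<and> \<Lambda> (\<lambda>_. 1) = 1 \<and>
     (\<forall>g\<in>CX X. \<forall>h\<in>CX X. \<Lambda> (\<lambda>x. g x + h x) = \<Lambda> g + \<Lambda> h) \<and>
     (\<forall>c. \<forall>g\<in>CX X. \<Lambda> (\<lambda>x. c * g x) = c * \<Lambda> g) \<and>
     (\<forall>g\<in>CX X. (\<forall>x\<in>X. 0 \<le> g x) \<longrightarrow> 0 \<le> \<Lambda> g)}"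

lemma CX_intros [intro, simp]:
  "(\<lambda>_. c) \<in> CX X"
  "g \<in> CX X \<Longrightarrow> h \<in> CX X \<Longrightarrow> (\<lambda>x. g x + h x) \<in> CX X"
  "g \<in> CX X \<Longrightarrow> h \<in> CX X \<Longrightarrow> (\<lambda>x. g x - h x) \<in> CX X"
  "g \<in> CX X \<Longrightarrow> h \<in> CX X \<Longrightarrow> (\<lambda>x. g x * h x) \<in> CX X"
  "g \<in> CX X \<Longrightarrow> (\<lambda>x. - g x) \<in> CX X"
  "g \<in> CX X \<Longrightarrow> h \<in> CX X \<Longrightarrow> (\<lambda>x. min (g x) (h x)) \<in> CX X"
  "(\<And>i. i \<in> I \<Longrightarrow> k i \<in> CX X) \<Longrightarrow> (\<lambda>x. \<Sum>i\<in>I. k i x) \<in> CX X"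
  by (auto simp: CX_def intro!: continuous_intros)

lemma CX_bounded:
  assumes "compact X" "g \<in> CX X"
  shows "\<exists>B. \<forall>x\<in>X. \<bar>g x\<bar> \<le> B"
proof -
  have "bounded (g ` X)"
    using assms by (auto simp: CX_def intro!: compact_imp_bounded compact_continuous_image)
  then show ?thesis by (auto simp: bounded_iff)
qed

text \<open>Truncated multiples of the distance to the complement. The value 1 is attained on
  \<open>A\<close>, not merely approached, and \<open>h 0 = 0\<close>; so the increments telescope
  to \<open>h J\<close>, and finitely many of them add up to 1 at each point of
  \<open>A\<close>.\<close>

lemma open_indicator_approx:
  fixes X :: "'x::metric_space set"
  assumes A: "openin (top_of_set X) A"
  obtains h :: "nat \<Rightarrow> 'x \<Rightarrow> real"
  where "\<And>n. h n \<in> CX X" "\<And>n x. 0 \<le> h n x" "\<And>n x. h n x \<le> 1"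
    "\<And>x. h 0 x = 0" "\<And>n x. h n x \<le> h (Suc n) x"
    "\<And>n x. x \<in> X - A \<Longrightarrow> h n x = 0" "\<And>x. x \<in> A \<Longrightarrow> \<exists>n. h n x = 1"
proof
  \<comment> \<open>\<open>infdist\<close> to the empty set is 0, so the case \<open>A = X\<close>
    gets the constant 1 instead.\<close>
  define r :: "'x \<Rightarrow> real" where "r x = (if X - A = {} then 1 else infdist x (X - A))" for x
  let ?h = "\<lambda>n x. min 1 (real n * r x)"
  have r0: "0 \<le> r x" for x by (simp add: r_def infdist_nonneg)
  have "continuous_on X r" unfolding r_def by (cases "X - A = {}") (auto intro!: continuous_intros)
  then show "?h n \<in> CX X" for n by (auto simp: CX_def intro!: continuous_intros)
  show "0 \<le> ?h n x" "?h n x \<le> 1" "?h 0 x = 0" for n x using r0[of x] by simp_all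
  show "?h n x \<le> ?h (Suc n) x" for n x
    using r0[of x] by (intro min.mono order_refl mult_right_mono) auto
  show "?h n x = 0" if "x \<in> X - A" for n x using that by (auto simp: r_def)
  show "\<exists>n. ?h n x = 1" if x: "x \<in> A" for x
  proof -
    have "0 < r x"
    proof (cases "X - A = {}")
      case False
      obtain T where T: "open T" "A = X \<inter> T" using A by (auto simp: openin_open)
      have "closure (X - A) \<subseteq> - T" using T by (intro closure_minimal) auto
      then have "x \<notin> closure (X - A)" using T x by auto
      then show ?thesis
        using False r0[of x] in_closure_iff_infdist_zero[OF False, of x] by (auto simp: r_def)
    qed (simp add: r_def)
    then obtain n where "1 < real n * r x" using reals_Archimedean3 by blast
    then show ?thesis by (intro exI[of _ n]) simp
  qed
qed

section \<open>Borel probability measures are determined by continuous functions\<close>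

lemma sets_restrict_borel:
  fixes X :: "'x::metric_space set"
  assumes "compact X"
  shows "sets (restrict_space borel X) = sigma_sets X {A. openin (top_of_set X) A}"
proof -
  have "X \<in> sigma_sets UNIV {S. open S}"
    using borel_closed[OF compact_imp_closed[OF assms]] by (simp add: borel_def)
  then have "(\<inter>) X ` sigma_sets UNIV {S. open S} = sigma_sets X ((\<inter>) X ` {S. open S})"
    by (rule sigma_sets_Int) simp
  moreover have "(\<inter>) X ` {S. open S} = {A. openin (top_of_set X) A}"
    by (auto simp: openin_open)
  ultimately show ?thesis by (simp add: sets_restrict_space borel_def)
qed

lemma prob_measures_space: "\<mu> \<in> prob_measures X \<Longrightarrow> space \<mu> = X"
  using sets_eq_imp_space_eq[of \<mu> "restrict_space borel X"]
  by (simp add: prob_measures_def space_restrict_space)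

lemma CX_measurable:
  assumes "\<mu> \<in> prob_measures X" "g \<in> CX X"
  shows "g \<in> borel_measurable \<mu>"
proof -
  have "borel_measurable \<mu> = borel_measurable (restrict_space borel X)"
    using assms(1) by (intro measurable_cong_sets) (simp_all add: prob_measures_def)
  moreover have "g \<in> borel_measurable (restrict_space borel X)"
    using assms(2) unfolding CX_def by (intro borel_measurable_continuous_on_restrict) simp
  ultimately show ?thesis by blast
qed

lemma CX_integrable:
  assumes "compact X" "\<mu> \<in> prob_measures X" "g \<in> CX X"
  shows "integrable \<mu> g"
proof -
  interpret prob_space \<mu> using assms by (simp add: prob_measures_def)
  obtain B where "\<forall>x\<in>X. \<bar>g x\<bar> \<le> B" using CX_bounded assms by blast
  then show ?thesis
    using CX_measurable[OF assms(2,3)]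
    by (intro integrable_const_bound[of g B]) (auto simp: prob_measures_space[OF assms(2)])
qed

text \<open>The relatively open sets form an intersection-stable generator, and by dominated
  convergence the measure of an open set is a limit of integrals of continuous functions.\<close>

lemma prob_measures_eqI:
  assumes X: "compact X" and \<mu>: "\<mu> \<in> prob_measures X" and \<nu>: "\<nu> \<in> prob_measures X"
    and eq: "\<And>g. g \<in> CX X \<Longrightarrow> (\<integral>x. g x \<partial>\<mu>) = (\<integral>x. g x \<partial>\<nu>)"
  shows "\<mu> = \<nu>"
proof (rule measure_eqI_generator_eq)
  let ?E = "{A. openin (top_of_set X) A}"
  show "Int_stable ?E" by (auto simp: Int_stable_def)
  show "?E \<subseteq> Pow X" using openin_imp_subset by auto
  show "sets \<mu> = sigma_sets X ?E" "sets \<nu> = sigma_sets X ?E"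
    using \<mu> \<nu> sets_restrict_borel[OF X] by (auto simp: prob_measures_def)
  show "range (\<lambda>_. X) \<subseteq> ?E" by auto
  show "(\<Union>i::nat. X) = X" by simp
  interpret M: prob_space \<mu> using \<mu> by (simp add: prob_measures_def)
  interpret N: prob_space \<nu> using \<nu> by (simp add: prob_measures_def)
  show "emeasure \<mu> X \<noteq> \<infinity>" by simp
  fix A assume "A \<in> ?E"
  then have A: "openin (top_of_set X) A" by simp
  obtain h :: "nat \<Rightarrow> _ \<Rightarrow> real" where h: "\<And>n. h n \<in> CX X" "\<And>n x. 0 \<le> h n x" "\<And>n x. h n x \<le> 1"
    "\<And>x. h 0 x = 0" "\<And>n x. h n x \<le> h (Suc n) x"
    "\<And>n x. x \<in> X - A \<Longrightarrow> h n x = 0" "\<And>x. x \<in> A \<Longrightarrow> \<exists>n. h n x = 1"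
    using open_indicator_approx[OF A] by metis
  have lim: "(\<lambda>n. h n x) \<longlonglongrightarrow> indicator A x" if "x \<in> X" for x
  proof (cases "x \<in> A")
    case True
    then obtain m where m: "h m x = 1" using h(7) by blast
    have "h n x = 1" if "m \<le> n" for n
      using lift_Suc_mono_le[of "\<lambda>n. h n x" m n] h(3)[of n x] h(5) m that by simp
    then have "\<forall>\<^sub>F n in sequentially. h n x = indicator A x"
      using True by (auto simp: eventually_sequentially)
    then show ?thesis by (rule tendsto_eventually)
  qed (use h(6) that in simp)
  have conv: "(\<lambda>n. \<integral>x. h n x \<partial>\<kappa>) \<longlonglongrightarrow> measure \<kappa> A" if \<kappa>: "\<kappa> \<in> prob_measures X" for \<kappa>
  proof -
    interpret K: prob_space \<kappa> using \<kappa> by (simp add: prob_measures_def)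
    have AK: "A \<in> sets \<kappa>"
      using \<kappa> A sets_restrict_borel[OF X] by (auto simp: prob_measures_def)
    have "(\<lambda>n. \<integral>x. h n x \<partial>\<kappa>) \<longlonglongrightarrow> (\<integral>x. indicator A x \<partial>\<kappa>)"
    proof (rule integral_dominated_convergence[where w = "\<lambda>_. 1"])
      show "AE x in \<kappa>. (\<lambda>n. h n x) \<longlonglongrightarrow> indicator A x"
        using lim by (intro AE_I2) (simp add: prob_measures_space[OF \<kappa>])
      show "AE x in \<kappa>. norm (h n x) \<le> 1" for n
        using h(2,3) by (intro AE_I2) auto
    qed (use AK h(1) CX_measurable[OF \<kappa>] in auto)
    then show ?thesis
      using sets.sets_into_space[OF AK] by (simp add: Int_absorb2)
  qed
  have "measure \<mu> A = measure \<nu> A"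
    using conv[OF \<mu>] conv[OF \<nu>] eq h(1) by (auto intro: LIMSEQ_unique)
  then show "emeasure \<mu> A = emeasure \<nu> A"
    by (simp add: M.emeasure_eq_measure N.emeasure_eq_measure)
qed

section \<open>Riesz representation of states by Daniell's construction\<close>

locale state =
  fixes X :: "'x::metric_space set" and \<Lambda> :: "('x \<Rightarrow> real) \<Rightarrow> real"
  assumes compact: "compact X" and state: "\<Lambda> \<in> states X"
begin

lemma add: "g \<in> CX X \<Longrightarrow> h \<in> CX X \<Longrightarrow> \<Lambda> (\<lambda>x. g x + h x) = \<Lambda> g + \<Lambda> h"
  and cmult: "g \<in> CX X \<Longrightarrow> \<Lambda> (\<lambda>x. c * g x) = c * \<Lambda> g"
  and nonneg: "g \<in> CX X \<Longrightarrow> (\<And>x. x \<in> X \<Longrightarrow> 0 \<le> g x) \<Longrightarrow> 0 \<le> \<Lambda> g"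
  and one: "\<Lambda> (\<lambda>_. 1) = 1"
  using state by (auto simp: states_def)

lemma const: "\<Lambda> (\<lambda>_. c) = c"
  using cmult[of "\<lambda>_. 1" c] one by simp

lemma diff:
  assumes "g \<in> CX X" "h \<in> CX X"
  shows "\<Lambda> (\<lambda>x. g x - h x) = \<Lambda> g - \<Lambda> h"
  using add[of "\<lambda>x. g x - h x" h] assms by simp

lemma mono:
  assumes "g \<in> CX X" "h \<in> CX X" "\<And>x. x \<in> X \<Longrightarrow> g x \<le> h x"
  shows "\<Lambda> g \<le> \<Lambda> h"
  using nonneg[of "\<lambda>x. h x - g x"] diff[of h g] assms by simp

lemma sum:
  assumes "finite I" "\<And>i. i \<in> I \<Longrightarrow> k i \<in> CX X"
  shows "\<Lambda> (\<lambda>x. \<Sum>i\<in>I. k i x) = (\<Sum>i\<in>I. \<Lambda> (k i))"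
  using assms by (induction I) (simp_all add: const add)

text \<open>A form of Dini's theorem: compactness makes \<open>\<Lambda>\<close> countably subadditive.\<close>

lemma dini:
  assumes g: "g \<in> CX X" and k: "\<And>n. k n \<in> CX X" "\<And>n x. x \<in> X \<Longrightarrow> 0 \<le> k n x"
    and le: "\<And>x. x \<in> X \<Longrightarrow> ennreal (g x) \<le> (\<Sum>n. ennreal (k n x))"
  shows "ennreal (\<Lambda> g) \<le> (\<Sum>n. ennreal (\<Lambda> (k n)))"
proof (rule ennreal_le_epsilon)
  fix e :: real assume e: "0 < e"
  \<comment> \<open>The points where \<open>N\<close> terms already come within \<open>e\<close> of
    \<open>g\<close>. These open sets increase with \<open>N\<close>, so the largest index in a
    finite subcover serves all of \<open>X\<close>.\<close>
  define V where "V N = {x\<in>X. g x - (\<Sum>n<N. k n x) < e}" for N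
  have Vopen: "openin (top_of_set X) (V N)" for N
  proof -
    have "continuous_on X (\<lambda>x. g x - (\<Sum>n<N. k n x))"
      using g k by (auto simp: CX_def intro!: continuous_intros)
    then have "openin (top_of_set X) (X \<inter> (\<lambda>x. g x - (\<Sum>n<N. k n x)) -` {..<e})"
      by (rule continuous_openin_preimage_gen) simp
    then show ?thesis by (simp add: V_def vimage_def Int_def)
  qed
  have "\<exists>N. x \<in> V N" if x: "x \<in> X" for x
  proof (cases "g x \<le> 0")
    case True
    then show ?thesis using x e by (auto simp: V_def intro!: exI[of _ 0])
  next
    case False
    \<comment> \<open>\<open>ennreal\<close> sends negative reals to 0, so strictness needs
      \<open>g x > 0\<close>; hence the case split.\<close>
    then have "ennreal (g x - e) < ennreal (g x)" using e by (intro ennreal_lessI) auto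
    also have "\<dots> \<le> (SUP N. \<Sum>n<N. ennreal (k n x))"
      using le[OF x] by (simp add: suminf_eq_SUP)
    finally obtain N where "ennreal (g x - e) < (\<Sum>n<N. ennreal (k n x))"
      by (auto simp: less_SUP_iff)
    also have "\<dots> = ennreal (\<Sum>n<N. k n x)" using k(2)[OF x] by simp
    finally have "g x - e < (\<Sum>n<N. k n x)" by (meson ennreal_leI linorder_not_le)
    then have "x \<in> V N" using x by (simp add: V_def algebra_simps)
    then show ?thesis ..
  qed
  then have "X \<subseteq> \<Union> (range V)" by auto
  then obtain D where D: "D \<subseteq> range V" "finite D" "X \<subseteq> \<Union>D"
    using compact Vopen unfolding compact_eq_openin_cover by (metis (no_types, lifting) imageE)
  then obtain I where I: "finite I" "D = V ` I" by (meson finite_subset_image)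
  define N where "N = Max (insert 0 I)"
  have "g x \<le> (\<Sum>n<N. k n x) + e" if x: "x \<in> X" for x
  proof -
    obtain M where M: "M \<in> I" "x \<in> V M" using D I x by auto
    then have "M \<le> N" using I by (auto simp: N_def)
    then have "(\<Sum>n<M. k n x) \<le> (\<Sum>n<N. k n x)" using k(2)[OF x] by (intro sum_mono2) auto
    then show ?thesis using M by (auto simp: V_def)
  qed
  then have "\<Lambda> g \<le> \<Lambda> (\<lambda>x. (\<Sum>n<N. k n x) + e)" using g k by (intro mono) auto
  also have "\<dots> = (\<Sum>n<N. \<Lambda> (k n)) + e" using k by (simp add: add const sum)
  finally have "ennreal (\<Lambda> g) \<le> ennreal ((\<Sum>n<N. \<Lambda> (k n)) + e)" by (rule ennreal_leI)
  also have "\<dots> = (\<Sum>n<N. ennreal (\<Lambda> (k n))) + ennreal e"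
    using k nonneg e by (simp add: sum_nonneg ennreal_plus)
  also have "\<dots> \<le> (\<Sum>n. ennreal (\<Lambda> (k n))) + ennreal e"
    by (intro add_right_mono sum_le_suminf) auto
  finally show "ennreal (\<Lambda> g) \<le> (\<Sum>n. ennreal (\<Lambda> (k n))) + ennreal e" .
qed

text \<open>Daniell's outer measure: covering a set by series of functions, rather than by open sets,
  makes countable subadditivity a matter of rearranging double series.\<close>

definition majorants :: "'x set \<Rightarrow> (nat \<Rightarrow> 'x \<Rightarrow> real) set" where
  "majorants A = {k. (\<forall>n. k n \<in> CX X \<and> (\<forall>x\<in>X. 0 \<le> k n x)) \<and>
     (\<forall>x\<in>A. 1 \<le> (\<Sum>n. ennreal (k n x)))}"

definition outer :: "'x set \<Rightarrow> ennreal" where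
  "outer A = (INF k\<in>majorants A. \<Sum>n. ennreal (\<Lambda> (k n)))"

text \<open>\<open>prod_decode\<close> lists the double family as a single majorant of
  \<open>A\<close>, and sums of nonnegative terms may be rearranged.\<close>

lemma outer_le_double_sum:
  assumes "\<And>m. (\<forall>n. k m n \<in> CX X \<and> (\<forall>x\<in>X. 0 \<le> k m n x))"
    and "\<And>x. x \<in> A \<Longrightarrow> 1 \<le> (\<Sum>m. \<Sum>n. ennreal (k m n x))"
  shows "outer A \<le> (\<Sum>m. \<Sum>n. ennreal (\<Lambda> (k m n)))"
proof -
  let ?c = "\<lambda>i. case prod_decode i of (m, n) \<Rightarrow> k m n"
  have "(\<Sum>i. ennreal (?c i x)) = (\<Sum>m. \<Sum>n. ennreal (k m n x))" for x
    by (subst suminf_ennreal_2dimen[of _ "\<lambda>(m, n). ennreal (k m n x)", symmetric])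
       (auto simp: case_prod_beta)
  then have *: "?c \<in> majorants A"
    using assms by (auto simp: majorants_def case_prod_beta)
  have "(\<Sum>i. ennreal (\<Lambda> (?c i))) = (\<Sum>m. \<Sum>n. ennreal (\<Lambda> (k m n)))"
    by (subst suminf_ennreal_2dimen[of _ "\<lambda>(m, n). ennreal (\<Lambda> (k m n))", symmetric])
       (auto simp: case_prod_beta)
  then show "outer A \<le> (\<Sum>m. \<Sum>n. ennreal (\<Lambda> (k m n)))"
    unfolding outer_def using * by (metis INF_lower)
qed

lemma outer_measure_space: "outer_measure_space (Pow X) outer"
  unfolding outer_measure_space_def
proof (intro conjI)
  have "outer {} \<le> (\<Sum>n::nat. ennreal (\<Lambda> (\<lambda>_. 0)))"
    unfolding outer_def by (intro INF_lower) (auto simp: majorants_def)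
  then show "positive (Pow X) outer" by (simp add: positive_def const)
  show "increasing (Pow X) outer"
    unfolding increasing_def outer_def by (auto intro!: INF_superset_mono simp: majorants_def)
  show "countably_subadditive (Pow X) outer"
    unfolding countably_subadditive_def
  proof (intro allI impI)
    fix A :: "nat \<Rightarrow> 'x set"
    show "outer (\<Union> (range A)) \<le> (\<Sum>m. outer (A m))"
    proof (rule ennreal_le_epsilon)
      fix e :: real assume e: "0 < e" and fin: "(\<Sum>m. outer (A m)) < Orderings.top_class.top"
      \<comment> \<open>Each majorant is optimal up to \<open>e / 2^(m+1)\<close>, and these errors
        sum to \<open>e\<close>. \<open>fin\<close> makes every \<open>outer (A m)\<close> finite,
        so that adding the error is a strict increase.\<close>
      have "\<exists>k\<in>majorants (A m). (\<Sum>n. ennreal (\<Lambda> (k n))) < outer (A m) + e * (1/2)^Suc m" for m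
      proof -
        have "outer (A m) < outer (A m) + e * (1/2)^Suc m"
          using e fin by (auto simp add: less_top dest!: ennreal_suminf_lessD)
        then show ?thesis unfolding outer_def[of "A m"] by (subst (asm) (1) INF_less_iff)
      qed
      then obtain k where k: "\<And>m. k m \<in> majorants (A m)"
          "\<And>m. (\<Sum>n. ennreal (\<Lambda> (k m n))) < outer (A m) + e * (1/2)^Suc m"
        by metis
      have "1 \<le> (\<Sum>m. \<Sum>n. ennreal (k m n x))" if "x \<in> A i" for x i
      proof -
        have "1 \<le> (\<Sum>n. ennreal (k i n x))" using k(1)[of i] that by (auto simp: majorants_def)
        also have "\<dots> = (\<Sum>m\<in>{i}. \<Sum>n. ennreal (k m n x))" by simp
        also have "\<dots> \<le> (\<Sum>m. \<Sum>n. ennreal (k m n x))" by (rule sum_le_suminf) auto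
        finally show ?thesis .
      qed
      then have "outer (\<Union> (range A)) \<le> (\<Sum>m. \<Sum>n. ennreal (\<Lambda> (k m n)))"
        using k(1) by (intro outer_le_double_sum) (auto simp: majorants_def)
      also have "\<dots> \<le> (\<Sum>m. outer (A m) + e * (1/2)^Suc m)"
        using k(2) by (intro suminf_le) (auto simp: less_imp_le)
      also have "... = (\<Sum>m. outer (A m)) + (\<Sum>m. ennreal e * ennreal ((1/2) ^ Suc m))"
        using \<open>0 < e\<close> by (subst suminf_add[symmetric])
                         (auto simp del: ennreal_suminf_cmult simp add: ennreal_mult[symmetric])
      also have "\<dots> = (\<Sum>m. outer (A m)) + e"
        unfolding ennreal_suminf_cmult
        by (subst suminf_ennreal_eq[OF zero_le_power power_half_series]) auto
      finally show "outer (\<Union> (range A)) \<le> (\<Sum>m. outer (A m)) + ennreal e" .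
    qed
  qed
qed

text \<open>A majorant of \<open>A\<close> dominates \<open>g\<close> on all of \<open>X\<close>: on
  \<open>A\<close> because \<open>g\<close> is at most 1 there, elsewhere because \<open>g\<close>
  is nonpositive. \<open>dini\<close> then compares the values of \<open>\<Lambda>\<close>.\<close>

lemma le_outer:
  assumes "g \<in> CX X" "A \<subseteq> X" "\<And>x. x \<in> X \<Longrightarrow> g x \<le> indicator A x"
  shows "ennreal (\<Lambda> g) \<le> outer A"
  unfolding outer_def
proof (rule INF_greatest)
  fix k assume k: "k \<in> majorants A"
  have "ennreal (g x) \<le> (\<Sum>n. ennreal (k n x))" if x: "x \<in> X" for x
  proof (cases "x \<in> A")
    case True
    then have "ennreal (g x) \<le> ennreal 1" using assms(3)[OF x] by (intro ennreal_leI) auto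
    also have "\<dots> \<le> (\<Sum>n. ennreal (k n x))" using True k by (auto simp: majorants_def)
    finally show ?thesis .
  next
    case False
    then show ?thesis using assms(3)[OF x] by (simp add: ennreal_neg)
  qed
  then show "ennreal (\<Lambda> g) \<le> (\<Sum>n. ennreal (\<Lambda> (k n)))"
    using k assms by (intro dini) (auto simp: majorants_def)
qed


text \<open>Caratheodory's condition comes from splitting a majorant \<open>k\<close> of
  \<open>E\<close> along \<open>A\<close>: increments of \<open>k n * h j\<close> majorise
  \<open>E \<inter> A\<close>, and \<open>k n * (1 - h (K n))\<close> majorises
  \<open>E - A\<close>. For large \<open>K n\<close> the two parts of \<open>k n\<close> together
  cost hardly more than \<open>\<Lambda> (k n)\<close>.\<close>

lemma open_in_lambda_system:
  assumes A: "openin (top_of_set X) A"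
  shows "A \<in> lambda_system X (Pow X) outer"
proof -
  have AX: "A \<subseteq> X" using A by (rule openin_imp_subset)
  obtain h where h: "\<And>n. h n \<in> CX X" "\<And>n x. 0 \<le> h n x" "\<And>n x. h n x \<le> 1"
    "\<And>x. h 0 x = 0" "\<And>n x. h n x \<le> h (Suc n) x"
    "\<And>n x. x \<in> X - A \<Longrightarrow> h n x = 0" "\<And>x. x \<in> A \<Longrightarrow> \<exists>n. h n x = 1"
    using open_indicator_approx[OF A] by metis
  have "outer (E \<inter> A) + outer (E - A) \<le> outer E" if E: "E \<subseteq> X" for E
    unfolding outer_def[of E]
  proof (rule INF_greatest)
    fix k assume "k \<in> majorants E"
    then have k: "\<And>n. k n \<in> CX X" "\<And>n x. x \<in> X \<Longrightarrow> 0 \<le> k n x"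
      "\<And>x. x \<in> E \<Longrightarrow> 1 \<le> (\<Sum>n. ennreal (k n x))"
      by (auto simp: majorants_def)
    show "outer (E \<inter> A) + outer (E - A) \<le> (\<Sum>n. ennreal (\<Lambda> (k n)))"
    proof (rule ennreal_le_epsilon)
      fix e :: real assume e: "0 < e"
      \<comment> \<open>The increments of \<open>h\<close> cut \<open>k n\<close> into nonnegative
        pieces with partial sums \<open>k n * h J\<close>; at a point of \<open>A\<close> some
        partial sum is already \<open>k n x\<close>. \<open>a n\<close> below is the cost of all
        pieces of \<open>k n\<close>.\<close>
      define u where "u n j x = k n x * (h (Suc j) x - h j x)" for n j x
      define a where "a n = (\<Sum>j. ennreal (\<Lambda> (u n j)))" for n
      have uC: "u n j \<in> CX X" for n j
        unfolding u_def using k h by auto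
      have u0: "0 \<le> u n j x" if "x \<in> X" for n j x
        using k(2)[OF that] h(5)[of j x] by (simp add: u_def)
      have usum: "(\<Sum>j<J. u n j x) = k n x * h J x" for n J x
        using sum_lessThan_telescope[of "\<lambda>j. h j x" J]
        by (simp add: u_def sum_distrib_left[symmetric] h)
      have khC: "(\<lambda>x. k n x * h J x) \<in> CX X" for n J
        using k h by auto
      have kh0: "0 \<le> \<Lambda> (\<lambda>x. k n x * h J x)" for n J
        using k h khC by (intro nonneg) auto
      have kh1: "0 \<le> \<Lambda> (\<lambda>x. k n x * (1 - h J x))" for n J
        using k h by (intro nonneg) auto
      have split: "\<Lambda> (\<lambda>x. k n x * h J x) + \<Lambda> (\<lambda>x. k n x * (1 - h J x)) = \<Lambda> (k n)" for n J
        using add[of "\<lambda>x. k n x * h J x" "\<lambda>x. k n x * (1 - h J x)"] k h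
        by (simp add: algebra_simps)
      have "(\<Sum>j<J. ennreal (\<Lambda> (u n j))) = ennreal (\<Lambda> (\<lambda>x. k n x * h J x))" for n J
        using sum[of "{..<J}" "u n"] uC nonneg u0 by (simp add: usum sum_ennreal)
      then have a_SUP: "a n = (SUP J. ennreal (\<Lambda> (\<lambda>x. k n x * h J x)))" for n
        by (simp add: a_def suminf_eq_SUP)
      \<comment> \<open>\<open>a n\<close> is at most \<open>\<Lambda> (k n)\<close>, hence finite,
        so finitely many pieces reach it up to \<open>e / 2^(n+1)\<close>.\<close>
      have "\<exists>J. a n \<le> ennreal (\<Lambda> (\<lambda>x. k n x * h J x)) + ennreal (e * (1/2)^Suc n)" for n
      proof -
        have "a n \<le> ennreal (\<Lambda> (k n))"
          unfolding a_SUP using split[of n] kh1[of n]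
          by (intro SUP_least ennreal_leI) (smt (verit))
        then have "a n \<noteq> \<infinity>" by (auto simp: top_unique)
        then have "\<exists>l\<in>range (\<lambda>J. ennreal (\<Lambda> (\<lambda>x. k n x * h J x))). a n < l + ennreal (e * (1/2)^Suc n)"
          unfolding a_SUP using e
          by (intro SUP_approx_ennreal) auto
        then show ?thesis by (auto intro: less_imp_le)
      qed
      then obtain K where K: "\<And>n. a n \<le> ennreal (\<Lambda> (\<lambda>x. k n x * h (K n) x)) + ennreal (e * (1/2)^Suc n)"
        by metis
      have "1 \<le> (\<Sum>n. \<Sum>j. ennreal (u n j x))" if x: "x \<in> E \<inter> A" for x
      proof -
        obtain J where J: "h J x = 1" using h(7)[of x] x by auto
        have "ennreal (k n x) \<le> (\<Sum>j. ennreal (u n j x))" for n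
        proof -
          have "ennreal (k n x) = (\<Sum>j<J. ennreal (u n j x))"
            using usum[of n x J] J u0[of x n] x E by (simp add: sum_ennreal subset_eq)
          also have "\<dots> \<le> (\<Sum>j. ennreal (u n j x))" by (rule sum_le_suminf) auto
          finally show ?thesis .
        qed
        then have "(\<Sum>n. ennreal (k n x)) \<le> (\<Sum>n. \<Sum>j. ennreal (u n j x))"
          by (intro suminf_le) auto
        then show ?thesis using k(3)[of x] x by (meson IntD1 order_trans)
      qed
      then have "outer (E \<inter> A) \<le> (\<Sum>n. a n)"
        unfolding a_def using uC u0 by (intro outer_le_double_sum) auto
      moreover have "outer (E - A) \<le> (\<Sum>n. ennreal (\<Lambda> (\<lambda>x. k n x * (1 - h (K n) x))))"
        unfolding outer_def
      proof (rule INF_lower)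
        \<comment> \<open>Stopping at the finite level \<open>K n\<close> keeps the function
          continuous; on \<open>E - A\<close>, where \<open>h\<close> vanishes, it still equals
          \<open>k n\<close>.\<close>
        have "1 \<le> (\<Sum>n. ennreal (k n x * (1 - h (K n) x)))" if "x \<in> E - A" for x
          using k(3)[of x] h(6)[of x] that E by (auto simp: subset_eq)
        then show "(\<lambda>n x. k n x * (1 - h (K n) x)) \<in> majorants (E - A)"
          using k h by (auto simp: majorants_def)
      qed
      ultimately have "outer (E \<inter> A) + outer (E - A)
          \<le> (\<Sum>n. a n) + (\<Sum>n. ennreal (\<Lambda> (\<lambda>x. k n x * (1 - h (K n) x))))"
        by (rule add_mono)
      also have "\<dots> = (\<Sum>n. a n + ennreal (\<Lambda> (\<lambda>x. k n x * (1 - h (K n) x))))"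
        by (rule suminf_add) auto
      also have "\<dots> \<le> (\<Sum>n. ennreal (\<Lambda> (k n)) + ennreal e * ennreal ((1/2) ^ Suc n))"
      proof (rule suminf_le)
        fix n
        have "a n + ennreal (\<Lambda> (\<lambda>x. k n x * (1 - h (K n) x)))
          \<le> ennreal (\<Lambda> (\<lambda>x. k n x * h (K n) x)) + ennreal (e * (1/2)^Suc n)
            + ennreal (\<Lambda> (\<lambda>x. k n x * (1 - h (K n) x)))"
          using K by (rule add_right_mono)
        also have "\<dots> = ennreal (\<Lambda> (k n)) + ennreal (e * (1/2)^Suc n)"
          using kh0 kh1 e by (simp flip: ennreal_plus split[of n "K n"] add: add_ac)
        also have "\<dots> = ennreal (\<Lambda> (k n)) + ennreal e * ennreal ((1/2) ^ Suc n)"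
          using e by (simp flip: ennreal_mult)
        finally show "a n + ennreal (\<Lambda> (\<lambda>x. k n x * (1 - h (K n) x)))
          \<le> ennreal (\<Lambda> (k n)) + ennreal e * ennreal ((1/2) ^ Suc n)" .
      qed auto
      also have "\<dots> = (\<Sum>n. ennreal (\<Lambda> (k n))) + (\<Sum>n. ennreal e * ennreal ((1/2) ^ Suc n))"
        by (rule suminf_add[symmetric]) auto
      also have "\<dots> = (\<Sum>n. ennreal (\<Lambda> (k n))) + e"
        unfolding ennreal_suminf_cmult
        by (subst suminf_ennreal_eq[OF zero_le_power power_half_series]) auto
      finally show "outer (E \<inter> A) + outer (E - A) \<le> (\<Sum>n. ennreal (\<Lambda> (k n))) + ennreal e" .
    qed
  qed
  moreover have "outer E \<le> outer (E \<inter> A) + outer (E - A)" if E: "E \<subseteq> X" for E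
  proof -
    have "subadditive (Pow X) outer"
      using outer_measure_space ring_of_sets.countably_subadditive_subadditive[OF ring_of_sets_Pow]
      unfolding outer_measure_space_def by blast
    from subadditiveD[OF this, of "E \<inter> A" "E - A"] E show ?thesis
      by (simp add: Int_Diff_Un Diff_Int_distrib) auto
  qed
  ultimately show ?thesis
    using AX unfolding algebra.lambda_system_eq[OF algebra_Pow] by (auto intro: antisym)
qed


text \<open>Caratheodory's theorem turns \<open>outer\<close> into a measure on a sigma-algebra that
  contains the open sets. For the integrals one inequality is enough, since it applies to
  \<open>-g\<close> as well.\<close>

lemma riesz: "\<exists>\<mu>\<in>prob_measures X. \<forall>g\<in>CX X. (\<integral>x. g x \<partial>\<mu>) = \<Lambda> g"
proof -
  let ?L = "lambda_system X (Pow X) outer"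
  define \<mu> where "\<mu> = measure_of X {A. openin (top_of_set X) A} outer"
  have subX: "{A. openin (top_of_set X) A} \<subseteq> Pow X" using openin_imp_subset by auto
  have L: "measure_space X ?L outer"
    using outer_measure_space by (rule sigma_algebra.caratheodory_lemma[OF sigma_algebra_Pow])
  then have sub: "sigma_sets X {A. openin (top_of_set X) A} \<subseteq> ?L"
    using open_in_lambda_system
    by (intro sigma_algebra.sigma_sets_subset) (auto simp: measure_space_def)
  then have em: "emeasure \<mu> A = outer A" if "A \<in> sigma_sets X {A. openin (top_of_set X) A}" for A
    using L that subX sub sets_measure_of[OF subX]
    by (intro emeasure_measure_of[OF \<mu>_def])
       (auto simp: measure_space_def positive_def countably_additive_def subset_eq \<mu>_def)
  have space: "space \<mu> = X" unfolding \<mu>_def using subX by (rule space_measure_of)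
  have sets: "sets \<mu> = sets (restrict_space borel X)"
    using subX by (simp add: \<mu>_def sets_restrict_borel compact)
  have "outer X = 1"
  proof (rule antisym)
    \<comment> \<open>The majorant 1, 0, 0, ... of \<open>X\<close> has cost 1.\<close>
    have "outer X \<le> (\<Sum>n. ennreal (\<Lambda> (if n = 0 then \<lambda>_. 1 else (\<lambda>_. 0))))"
      unfolding outer_def
    proof (rule INF_lower)
      have "(\<Sum>n::nat. ennreal ((if n = 0 then \<lambda>_. 1 else (\<lambda>_. 0)) x)) = 1" for x :: 'x
        by (subst suminf_finite[of "{0}"]) auto
      then show "(\<lambda>n. if n = 0 then \<lambda>_. 1 else (\<lambda>_. 0)) \<in> majorants X"
        by (auto simp: majorants_def)
    qed
    also have "\<dots> = 1" by (subst suminf_finite[of "{0}"]) (auto simp: one const)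
    finally show "outer X \<le> 1" .
    show "1 \<le> outer X" using le_outer[of "\<lambda>_. 1" X] by (simp add: one)
  qed
  then have prob: "prob_space \<mu>"
    by (intro prob_spaceI) (simp add: space em sigma_sets_top)
  interpret prob_space \<mu> by (rule prob)
  have int: "integrable \<mu> g" if "g \<in> CX X" for g
    using prob sets compact that by (intro CX_integrable) (auto simp: prob_measures_def)
  text \<open>For the slices \<open>min g ((k+1)/N) - min g (k/N)\<close> of \<open>g\<close>, \<open>\<Lambda>\<close> of a slice is at most the
    integral of the preceding one, through the measure of \<open>{g > k/N}\<close>.\<close>
  have le01: "\<Lambda> g \<le> (\<integral>x. g x \<partial>\<mu>)" if g: "g \<in> CX X" and g01: "\<And>x. x \<in> X \<Longrightarrow> 0 \<le> g x \<and> g x \<le> 1" for g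
  proof (rule field_le_epsilon)
    fix e :: real assume "0 < e"
    then obtain N :: nat where N: "0 < N" "1 / real N < e"
      by (metis nat_approx_posE of_nat_Suc zero_less_Suc)
    define c where "c k x = min (g x) (real k / real N)" for k x
    define s where "s k x = c (Suc k) x - c k x" for k x
    have cC: "c k \<in> CX X" for k unfolding c_def using g by auto
    have sC: "s k \<in> CX X" for k unfolding s_def using cC by auto
    have gs: "(\<Sum>k<N. s k x) = g x" if "x \<in> X" for x
      using sum_lessThan_telescope[of "\<lambda>k. c k x" N] g01[OF that] N by (simp add: s_def c_def)
    have s_ge: "0 \<le> s k x" for k x
      unfolding s_def c_def using N by (auto simp: min_def field_simps)
    have s_le: "s k x \<le> 1 / real N" for k x
      unfolding s_def c_def using N by (auto simp: min_def field_simps)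
    define A where "A k = {x\<in>X. real k / real N < g x}" for k
    have Aopen: "openin (top_of_set X) (A k)" for k
    proof -
      have "openin (top_of_set X) (X \<inter> g -` {real k / real N<..})"
        using g by (intro continuous_openin_preimage_gen) (auto simp: CX_def)
      then show ?thesis by (simp add: A_def vimage_def Int_def)
    qed
    have AM: "A k \<in> sets \<mu>" for k
      using Aopen[of k] subX by (auto simp: \<mu>_def)
    \<comment> \<open>The rescaled slice \<open>N * s k\<close> lies between the indicators of
      \<open>A (Suc k)\<close> and \<open>A k\<close>. \<open>up\<close> uses the larger one through
      \<open>le_outer\<close>, \<open>down\<close> the smaller one under the integral.\<close>
    have up: "real N * \<Lambda> (s k) \<le> measure \<mu> (A k)" for k
    proof -
      have "ennreal (\<Lambda> (\<lambda>x. real N * s k x)) \<le> outer (A k)"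
      proof (rule le_outer)
        fix x assume "x \<in> X"
        show "real N * s k x \<le> indicator (A k) x"
        proof (cases "x \<in> A k")
          case True
          then show ?thesis using s_le[of k x] N by (simp add: field_simps)
        next
          case False
          then have "g x \<le> real k / real N" using \<open>x \<in> X\<close> by (simp add: A_def)
          moreover have "real k / real N \<le> real (Suc k) / real N" by (simp add: divide_right_mono)
          ultimately have "s k x = 0" by (simp add: s_def c_def)
          then show ?thesis using False by simp
        qed
      qed (use sC in \<open>auto simp: A_def\<close>)
      also have "outer (A k) = emeasure \<mu> (A k)" using Aopen by (intro em[symmetric]) auto
      also have "\<dots> = ennreal (measure \<mu> (A k))" by (rule emeasure_eq_measure)
      finally show ?thesis using cmult[OF sC] by (simp add: ennreal_le_iff)
    qed
    have down: "measure \<mu> (A (Suc k)) \<le> real N * (\<integral>x. s k x \<partial>\<mu>)" for k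
    proof -
      have "measure \<mu> (A (Suc k)) = (\<integral>x. indicator (A (Suc k)) x \<partial>\<mu>)"
        using AM sets.sets_into_space[OF AM] by (simp add: Int_absorb2)
      also have "\<dots> \<le> (\<integral>x. real N * s k x \<partial>\<mu>)"
      proof (rule integral_mono)
        fix x
        show "indicator (A (Suc k)) x \<le> real N * s k x"
        proof (cases "x \<in> A (Suc k)")
          case True
          then have "real (Suc k) / real N < g x" by (simp add: A_def)
          moreover have "real k / real N \<le> real (Suc k) / real N" by (simp add: divide_right_mono)
          ultimately have "s k x = 1 / real N" by (simp add: s_def c_def diff_divide_distrib[symmetric])
          then show ?thesis using N True by simp
        next
          case False
          then show ?thesis using s_ge[of k x] by simp
        qed
      qed (use AM int sC in \<open>auto simp: less_top[symmetric]\<close>)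
      finally show ?thesis by simp
    qed
    \<comment> \<open>\<open>up\<close> for \<open>k\<close> and \<open>down\<close> for
      \<open>k - 1\<close> meet at the measure of \<open>A k\<close>. Slice 0 has no predecessor;
      its bound \<open>1 / N\<close> is the whole error.\<close>
    have "\<Lambda> (s k) \<le> (if k = 0 then 1 / real N else (\<integral>x. s (k - 1) x \<partial>\<mu>))" for k
    proof (cases k)
      case 0
      have "\<Lambda> (s 0) \<le> \<Lambda> (\<lambda>_. 1 / real N)" using sC s_le by (intro mono) auto
      then show ?thesis using 0 by (simp add: const)
    next
      case (Suc j)
      have "real N * \<Lambda> (s k) \<le> real N * (\<integral>x. s j x \<partial>\<mu>)" using up[of k] down[of j] Suc by simp
      then show ?thesis using N Suc by simp
    qed
    then have "(\<Sum>k<N. \<Lambda> (s k)) \<le> (\<Sum>k<N. if k = 0 then 1 / real N else (\<integral>x. s (k - 1) x \<partial>\<mu>))"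
      by (rule sum_mono)
    also have "\<dots> = 1 / real N + (\<Sum>k<N - 1. \<integral>x. s k x \<partial>\<mu>)"
      using N by (cases N) (simp_all add: sum.lessThan_Suc_shift del: sum.lessThan_Suc)
    also have "\<dots> \<le> 1 / real N + (\<Sum>k<N. \<integral>x. s k x \<partial>\<mu>)"
      using s_ge by (intro add_left_mono sum_mono2) (auto intro!: integral_nonneg)
    also have "(\<Sum>k<N. \<integral>x. s k x \<partial>\<mu>) = (\<integral>x. (\<Sum>k<N. s k x) \<partial>\<mu>)"
      using int sC by (simp add: integral_sum)
    also have "\<dots> = (\<integral>x. g x \<partial>\<mu>)" by (intro Bochner_Integration.integral_cong) (auto simp: space gs)
    finally have 1: "(\<Sum>k<N. \<Lambda> (s k)) \<le> 1 / real N + (\<integral>x. g x \<partial>\<mu>)" .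
    have "\<Lambda> g \<le> \<Lambda> (\<lambda>x. \<Sum>k<N. s k x)" using g sC gs by (intro mono) auto
    also have "\<dots> = (\<Sum>k<N. \<Lambda> (s k))" using sC by (simp add: sum)
    finally show "\<Lambda> g \<le> (\<integral>x. g x \<partial>\<mu>) + e" using 1 N by linarith
  qed
  have le: "\<Lambda> g \<le> (\<integral>x. g x \<partial>\<mu>)" if g: "g \<in> CX X" for g
  proof -
    obtain B' where B': "\<forall>x\<in>X. \<bar>g x\<bar> \<le> B'" using CX_bounded[OF compact g] by blast
    define B where "B = max B' 1"
    \<comment> \<open>With \<open>B\<close> positive, an affine map takes \<open>[-B, B]\<close> to
      \<open>[0, 1]\<close>; it preserves the inequality, as \<open>\<Lambda>\<close> and
      \<open>\<mu>\<close> both give constants their own value.\<close>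
    have B: "0 < B" "\<And>x. x \<in> X \<Longrightarrow> \<bar>g x\<bar> \<le> B" using B' by (auto simp: B_def)
    define g' where "g' x = 1 / (2 * B) * g x + 1 / 2" for x
    have "g' \<in> CX X" unfolding g'_def using g by (intro CX_intros)
    moreover have "0 \<le> g' x \<and> g' x \<le> 1" if "x \<in> X" for x
      using B(2)[OF that] B(1) by (auto simp: g'_def field_simps)
    ultimately have "\<Lambda> g' \<le> (\<integral>x. g' x \<partial>\<mu>)" by (rule le01)
    moreover have "\<Lambda> g' = 1 / (2 * B) * \<Lambda> g + 1 / 2"
      unfolding g'_def
      using add[OF CX_intros(4)[OF CX_intros(1)[of "1 / (2 * B)"] g] CX_intros(1)[of "1 / 2"]]
        cmult[OF g, of "1 / (2 * B)"] const[of "1 / 2"] by simp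
    moreover have "(\<integral>x. g' x \<partial>\<mu>) = 1 / (2 * B) * (\<integral>x. g x \<partial>\<mu>) + 1 / 2"
      unfolding g'_def using int[OF g] by (simp add: prob_space)
    ultimately show ?thesis using B(1) by (simp add: field_simps)
  qed
  have "(\<integral>x. g x \<partial>\<mu>) = \<Lambda> g" if g: "g \<in> CX X" for g
  proof (rule antisym)
    have "\<Lambda> (\<lambda>x. (-1) * g x) \<le> (\<integral>x. (-1) * g x \<partial>\<mu>)" using g by (intro le) auto
    then show "(\<integral>x. g x \<partial>\<mu>) \<le> \<Lambda> g" using cmult[OF g, of "-1"] by simp
  qed (rule le[OF g])
  then show ?thesis using prob sets by (auto simp: prob_measures_def)
qed

end

section \<open>Weak* compactness of the state space\<close>

text \<open>The Banach-Alaoglu argument: a bound for \<open>g\<close> on \<open>X\<close> also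
  bounds its value under a state, so Tychonoff's theorem applies, and each defining condition
  involves finitely many coordinates and is closed.\<close>

lemma compact_states:
  assumes "compact X"
  shows "compact (states X)"
proof -
  obtain B where B: "\<And>g. g \<in> CX X \<Longrightarrow> \<forall>x\<in>X. \<bar>g x\<bar> \<le> B g"
    using CX_bounded[OF assms] by metis
  define I where "I g = (if g \<in> CX X then {- B g..B g} else {0})" for g
  have "compactin (product_topology (\<lambda>_. euclidean) UNIV) (PiE UNIV I)"
    unfolding compactin_PiE by (auto simp: I_def)
  then have "compact (PiE UNIV I)" by (simp add: euclidean_product_topology)
  moreover have "closed (states X)"
    unfolding states_def Ball_def
    by (intro closed_Collect_conj closed_Collect_all closed_Collect_imp closed_Collect_eq
        closed_Collect_le open_Collect_const continuous_intros) auto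
  moreover have "states X \<subseteq> PiE UNIV I"
  proof
    fix \<Lambda> assume \<Lambda>: "\<Lambda> \<in> states X"
    interpret state X \<Lambda> using assms \<Lambda> by unfold_locales
    have "\<Lambda> g \<in> {- B g..B g}" if g: "g \<in> CX X" for g
      using mono[of g "\<lambda>_. B g"] mono[of "\<lambda>_. - B g" g] B[OF g] g by (auto simp: const abs_le_iff minus_le_iff)
    then show "\<Lambda> \<in> PiE UNIV I" using \<Lambda> by (auto simp: I_def states_def)
  qed
  ultimately show ?thesis by (metis compact_Int_closed inf.absorb_iff2)
qed

section \<open>Empirical measures\<close>

lemma sofic_Map_iff:
  assumes "F \<in> FinNE S"
  shows "\<phi> \<in> sofic_Map X \<alpha> d F \<delta> \<sigma> \<longleftrightarrow>
    \<phi> \<in> pow_space X d \<and> (\<forall>s\<in>F. rho2 d (\<phi> \<circ> \<sigma> s) (\<alpha> s \<circ> \<phi>) < \<delta>)"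
  using assms by (auto simp: sofic_Map_def FinNE_def)

lemma sofic_Map_measure_iff:
  assumes "F \<in> FinNE S" "L \<in> FinNE C"
  shows "\<phi> \<in> sofic_Map_measure X \<alpha> \<mu> d L F \<delta> \<sigma> \<longleftrightarrow>
    \<phi> \<in> pow_space X d \<and> (\<forall>s\<in>F. rho2 d (\<phi> \<circ> \<sigma> s) (\<alpha> s \<circ> \<phi>) < \<delta>) \<and>
    (\<forall>g\<in>L. \<bar>1 / real d * (\<Sum>j=1..d. g (\<phi> j)) - (\<integral>x. g x \<partial>\<mu>)\<bar> < \<delta>)"
  using assms(2) by (simp add: sofic_Map_measure_def sofic_Map_iff[OF assms(1)] FinNE_def)

lemma FinNE_insert: "a \<in> S \<Longrightarrow> F \<in> FinNE S \<Longrightarrow> insert a F \<in> FinNE S"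
  and FinNE_singleton: "a \<in> S \<Longrightarrow> {a} \<in> FinNE S"
  by (auto simp: FinNE_def)

text \<open>Integration against the uniform measure on the points of \<open>\<phi>\<close>, extended
  by 0 off \<open>CX X\<close> so as to be an element of \<open>states\<close>.\<close>

definition empirical :: "'x::metric_space set \<Rightarrow> nat \<Rightarrow> (nat \<Rightarrow> 'x) \<Rightarrow> ('x \<Rightarrow> real) \<Rightarrow> real" where
  "empirical X d \<phi> g = (if g \<in> CX X then 1 / real d * (\<Sum>j=1..d. g (\<phi> j)) else 0)"

lemma pow_space_mem: "\<phi> \<in> pow_space X d \<Longrightarrow> j \<in> {1..d} \<Longrightarrow> \<phi> j \<in> X"
  by (auto simp: pow_space_def PiE_iff)

lemma empirical_state:
  assumes "\<phi> \<in> pow_space X d" "0 < d"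
  shows "empirical X d \<phi> \<in> states X"
  unfolding states_def
proof (intro CollectI conjI allI ballI impI)
  show "empirical X d \<phi> (\<lambda>_. 1) = 1" using assms(2) by (simp add: empirical_def)
  show "empirical X d \<phi> (\<lambda>x. g x + h x) = empirical X d \<phi> g + empirical X d \<phi> h"
    if "g \<in> CX X" "h \<in> CX X" for g h
    using that by (simp add: empirical_def sum.distrib distrib_left)
  show "empirical X d \<phi> (\<lambda>x. c * g x) = c * empirical X d \<phi> g" if "g \<in> CX X" for c g
    using that CX_intros(4)[OF CX_intros(1) that, of c]
    by (simp add: empirical_def sum_distrib_left[symmetric])
  show "0 \<le> empirical X d \<phi> g" if "\<forall>x\<in>X. 0 \<le> g x" for g
    using that pow_space_mem[OF assms(1)]
    by (auto simp: empirical_def intro!: divide_nonneg_nonneg sum_nonneg)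
qed (simp add: empirical_def)

section \<open>Continuity of the action and exclusion of non-invariant measures\<close>

lemma action_continuous:
  assumes "continuous_action G X \<alpha>" "s \<in> carrier G"
  shows "continuous_on X (\<alpha> s)" "\<And>x. x \<in> X \<Longrightarrow> \<alpha> s x \<in> X"
proof -
  have "continuous_map (top_of_set X) (prod_topology (discrete_topology (carrier G)) (top_of_set X)) (\<lambda>x. (s, x))"
    using assms(2) by (intro continuous_map_pairedI) (auto simp: continuous_map_const)
  then have "continuous_map (top_of_set X) (top_of_set X) ((\<lambda>(s, x). \<alpha> s x) \<circ> (\<lambda>x. (s, x)))"
    using assms(1) unfolding continuous_action_def by (blast intro: continuous_map_compose)
  then show "continuous_on X (\<alpha> s)" "\<And>x. x \<in> X \<Longrightarrow> \<alpha> s x \<in> X"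
    by (auto simp: comp_def continuous_map_in_subtopology)
qed

text \<open>Along an almost equivariant map, averaging \<open>g \<circ> \<alpha> s\<close> and averaging \<open>g\<close> give almost the
  same result, because \<open>\<sigma> s\<close> is a permutation; so the limits of empirical measures are invariant.\<close>

lemma sofic_Map_measure_empty:
  assumes X: "compact X" and act: "continuous_action G X \<alpha>"
    and \<mu>: "\<mu> \<in> prob_measures X" and ninv: "\<mu> \<notin> invariant_measures G X \<alpha>"
  shows "\<exists>L\<in>FinNE (CX X). \<exists>F\<in>FinNE (carrier G). \<exists>\<delta>>0. \<forall>d>0. \<forall>\<sigma>.
    (\<forall>s\<in>carrier G. \<sigma> s permutes {1..d}) \<longrightarrow> sofic_Map_measure X \<alpha> \<mu> d L F \<delta> \<sigma> = {}"
proof -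
  obtain s where s: "s \<in> carrier G" "distr \<mu> \<mu> (\<alpha> s) \<noteq> \<mu>"
    using \<mu> ninv by (auto simp: invariant_measures_def)
  note \<alpha> = action_continuous[OF act s(1)]
  interpret prob_space \<mu> using \<mu> by (simp add: prob_measures_def)
  have "\<alpha> s \<in> restrict_space borel X \<rightarrow>\<^sub>M restrict_space borel X"
    using \<alpha> by (intro measurable_restrict_space2 borel_measurable_continuous_on_restrict)
      (auto simp: space_restrict_space)
  then have meas: "\<alpha> s \<in> \<mu> \<rightarrow>\<^sub>M \<mu>"
    using \<mu> measurable_cong_sets[of \<mu> "restrict_space borel X" \<mu> "restrict_space borel X"]
    by (simp add: prob_measures_def)
  have "distr \<mu> \<mu> (\<alpha> s) \<in> prob_measures X"
    using \<mu> prob_space_distr[OF meas] by (auto simp: prob_measures_def)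
  then obtain g where g: "g \<in> CX X" "(\<integral>x. g x \<partial>distr \<mu> \<mu> (\<alpha> s)) \<noteq> (\<integral>x. g x \<partial>\<mu>)"
    using prob_measures_eqI[OF X _ \<mu>] s(2) by blast
  define k where "k x = g (\<alpha> s x)" for x
  have k: "k \<in> CX X"
    using g(1) \<alpha> continuous_on_compose2[of X g X "\<alpha> s"] by (auto simp: CX_def k_def)
  \<comment> \<open>The defect of invariance, tested on \<open>g\<close>. Both \<open>g\<close> and
    \<open>k\<close> go into \<open>L\<close>, so averages along an admissible map would have to
    show nearly the same defect.\<close>
  define \<eta> where "\<eta> = \<bar>(\<integral>x. k x \<partial>\<mu>) - (\<integral>x. g x \<partial>\<mu>)\<bar>"
  have \<eta>: "0 < \<eta>"
    using g(2) integral_distr[OF meas CX_measurable[OF \<mu> g(1)]] by (simp add: \<eta>_def k_def)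
  obtain B' where B': "\<forall>x\<in>X. \<bar>g x\<bar> \<le> B'" using CX_bounded[OF X g(1)] by blast
  define B where "B = max B' 1"
  have B: "\<And>x. x \<in> X \<Longrightarrow> \<bar>g x\<bar> \<le> B" "0 < B" using B' by (auto simp: B_def)
  have "uniformly_continuous_on X g"
    using g(1) X by (simp add: CX_def compact_uniformly_continuous)
  then obtain e where e: "0 < e" "\<And>x y. x \<in> X \<Longrightarrow> y \<in> X \<Longrightarrow> dist x y < e \<Longrightarrow> \<bar>g x - g y\<bar> < \<eta> / 4"
    using uniformly_continuous_onE[of X g "\<eta> / 4"] \<eta> unfolding dist_real_def
    by (metis abs_minus_commute dist_commute divide_pos_pos zero_less_numeral)
  \<comment> \<open>With this \<open>C\<close>, pairs at distance at least \<open>e\<close> satisfy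
    \<open>2 * B \<le> C * dist^2\<close>. Thus \<open>near\<close> is uniform continuity in a form
    that can be averaged against the square of \<open>rho2\<close>.\<close>
  define C where "C = 2 * B / e\<^sup>2"
  have C: "0 < C" using B(2) e(1) by (simp add: C_def)
  have near: "\<bar>g x - g y\<bar> \<le> \<eta> / 4 + C * (dist x y)\<^sup>2" if "x \<in> X" "y \<in> X" for x y
  proof (cases "dist x y < e")
    case True
    then have "\<bar>g x - g y\<bar> < \<eta> / 4" using e that by blast
    moreover have "0 \<le> C * (dist x y)\<^sup>2" using C by simp
    ultimately show ?thesis by linarith
  next
    case False
    then have "e\<^sup>2 \<le> (dist x y)\<^sup>2" using e(1) by (intro power_mono) auto
    then have "C * e\<^sup>2 \<le> C * (dist x y)\<^sup>2" using C by simp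
    moreover have "C * e\<^sup>2 = 2 * B" using e(1) by (simp add: C_def)
    ultimately show ?thesis using B(1)[OF that(1)] B(1)[OF that(2)] \<eta> by linarith
  qed
  \<comment> \<open>The bounds 1 and \<open>\<eta> / (4 * C)\<close> give
    \<open>C * \<delta>^2 \<le> \<eta> / 4\<close>; the bound \<open>\<eta> / 8\<close> keeps the
    two sampling errors below \<open>\<eta> / 4\<close> in total. Altogether the defect would be
    less than \<open>3 * \<eta> / 4\<close>.\<close>
  define \<delta> where "\<delta> = min 1 (min (\<eta> / 8) (\<eta> / (4 * C)))"
  have \<delta>: "0 < \<delta>" using \<eta> C by (simp add: \<delta>_def)
  have "\<delta> \<le> 1" by (simp add: \<delta>_def)
  then have "\<delta>\<^sup>2 \<le> \<delta>" using \<delta> power_decreasing[of 1 2 \<delta>] by simp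
  then have "C * \<delta>\<^sup>2 \<le> C * \<delta>" using C by simp
  also have "\<dots> \<le> C * (\<eta> / (4 * C))" using C by (intro mult_left_mono) (auto simp: \<delta>_def)
  finally have C\<delta>: "C * \<delta>\<^sup>2 \<le> \<eta> / 4" using C by simp
  have L: "{g, k} \<in> FinNE (CX X)" and F: "{s} \<in> FinNE (carrier G)"
    using g k s by (auto simp: FinNE_def)
  have False if d: "0 < d" and perm: "\<sigma> s permutes {1..d}"
    and \<phi>: "\<phi> \<in> sofic_Map_measure X \<alpha> \<mu> d {g, k} {s} \<delta> \<sigma>" for d \<sigma> \<phi>
  proof -
    have \<phi>X: "\<phi> \<in> pow_space X d" and r: "rho2 d (\<phi> \<circ> \<sigma> s) (\<alpha> s \<circ> \<phi>) < \<delta>"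
      and ag: "\<bar>1 / real d * (\<Sum>j=1..d. g (\<phi> j)) - (\<integral>x. g x \<partial>\<mu>)\<bar> < \<delta>"
      and ak: "\<bar>1 / real d * (\<Sum>j=1..d. k (\<phi> j)) - (\<integral>x. k x \<partial>\<mu>)\<bar> < \<delta>"
      using \<phi> unfolding sofic_Map_measure_iff[OF F L] by auto
    let ?r = "\<lambda>j. (dist (\<phi> (\<sigma> s j)) (\<alpha> s (\<phi> j)))\<^sup>2"
    have rho: "1 / real d * (\<Sum>j=1..d. ?r j) \<le> \<delta>\<^sup>2"
    proof -
      have "sqrt (1 / real d * (\<Sum>j=1..d. ?r j)) < \<delta>" using r by (simp add: rho2_def)
      then show ?thesis by (metis less_imp_le real_sqrt_le_iff real_sqrt_unique \<delta>)
    qed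
    have "(\<Sum>j=1..d. g (\<phi> j)) = (\<Sum>j=1..d. g (\<phi> (\<sigma> s j)))"
      using sum.permute[OF perm, of "\<lambda>j. g (\<phi> j)"] by (simp add: comp_def)
    then have "\<bar>(\<Sum>j=1..d. g (\<phi> j)) - (\<Sum>j=1..d. k (\<phi> j))\<bar>
        = \<bar>\<Sum>j=1..d. g (\<phi> (\<sigma> s j)) - g (\<alpha> s (\<phi> j))\<bar>"
      by (simp add: sum_subtractf k_def)
    also have "\<dots> \<le> (\<Sum>j=1..d. \<eta> / 4 + C * ?r j)"
      using pow_space_mem[OF \<phi>X] permutes_in_image[OF perm] \<alpha>(2)
      by (intro order_trans[OF sum_abs] sum_mono near) auto
    also have "\<dots> = real d * (\<eta> / 4 + C * (1 / real d * (\<Sum>j=1..d. ?r j)))"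
      using d by (simp add: sum.distrib sum_distrib_left[symmetric] distrib_left)
    also have "\<dots> \<le> real d * (\<eta> / 4 + C * \<delta>\<^sup>2)"
      using rho C by (intro mult_left_mono add_left_mono) auto
    also have "\<dots> \<le> real d * (\<eta> / 2)" using C\<delta> by (intro mult_left_mono) auto
    finally have "\<bar>1 / real d * (\<Sum>j=1..d. g (\<phi> j)) - 1 / real d * (\<Sum>j=1..d. k (\<phi> j))\<bar> \<le> \<eta> / 2"
      using d by (simp add: diff_divide_distrib[symmetric] abs_divide field_simps)
    moreover have "\<delta> \<le> \<eta> / 8" by (simp add: \<delta>_def)
    moreover have "\<not> 0 < \<bar>b - a\<bar>"
      if "\<bar>p - q\<bar> \<le> \<bar>b - a\<bar> / 2" "t \<le> \<bar>b - a\<bar> / 8" "\<bar>p - a\<bar> < t" "\<bar>q - b\<bar> < t" for a b p q t :: real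
    proof -
      have "\<bar>b - a\<bar> \<le> \<bar>q - b\<bar> + \<bar>p - q\<bar> + \<bar>p - a\<bar>" by arith
      then show ?thesis using that by linarith
    qed
    ultimately show False using ag ak \<eta> unfolding \<eta>_def by blast
  qed
  then show ?thesis using L F \<delta> s(1) by (metis equals0I)
qed

section \<open>Exponential growth rates\<close>

abbreviation growth :: "(nat \<Rightarrow> nat) \<Rightarrow> (nat \<Rightarrow> ennreal) \<Rightarrow> ereal" where
  "growth d a \<equiv> limsup (\<lambda>i. ereal (1 / real (d i)) * elog (a i))"

lemma elog_mono: "a \<le> b \<Longrightarrow> elog a \<le> elog b"
  by (cases a; cases b) (auto simp: elog_def top_unique)

lemma growth_mono:
  assumes "\<And>i. a i \<le> b i"
  shows "growth d a \<le> growth d b"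
  using assms by (intro Limsup_mono always_eventually allI ereal_mult_left_mono elog_mono) auto

lemma growth_lessD:
  assumes "filterlim d at_top sequentially" "growth d a < ereal c"
  shows "\<forall>\<^sub>F i in sequentially. a i < ennreal (exp (real (d i) * c))"
proof -
  have "\<forall>\<^sub>F i in sequentially. 0 < d i" using assms(1) eventually_gt_at_top filterlim_iff by blast
  moreover have "\<forall>\<^sub>F i in sequentially. ereal (1 / real (d i)) * elog (a i) < ereal c"
    using assms(2) by (rule Limsup_lessD)
  ultimately show ?thesis
  proof eventually_elim
    case (elim i)
    show ?case
    proof (cases "a i")
      case (real r)
      show ?thesis
      proof (cases "r = 0")
        case False
        then have "1 / real (d i) * ln r < c" using elim real by (simp add: elog_def)
        then have "ln r < real (d i) * c" using elim(1) by (simp add: field_simps)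
        then have "r < exp (real (d i) * c)" using False real by (metis exp_less_cancel_iff exp_ln less_eq_real_def)
        then show ?thesis using real by (simp add: ennreal_less_iff)
      qed (use real in simp)
    next
      case top
      then show ?thesis using elim by (simp add: elog_def)
    qed
  qed
qed

text \<open>A fixed factor \<open>K\<close> adds only \<open>ln K / d i\<close>, which tends to 0.
  It will absorb the number of weak* neighbourhoods.\<close>

lemma growth_leI:
  assumes d: "filterlim d at_top sequentially" and K: "0 < K"
    and le: "\<forall>\<^sub>F i in sequentially. a i \<le> ennreal (K * exp (real (d i) * c))"
  shows "growth d a \<le> ereal c"
proof -
  have "\<forall>\<^sub>F i in sequentially. 0 < d i" using d eventually_gt_at_top filterlim_iff by blast
  then have "\<forall>\<^sub>F i in sequentially. ereal (1 / real (d i)) * elog (a i) \<le> ereal (ln K / real (d i) + c)"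
    using le
  proof eventually_elim
    case (elim i)
    have "elog (a i) \<le> ereal (ln K + real (d i) * c)"
      using elog_mono[OF elim(2)] K by (simp add: elog_def ln_mult)
    then have "ereal (1 / real (d i)) * elog (a i) \<le> ereal (1 / real (d i)) * ereal (ln K + real (d i) * c)"
      by (intro ereal_mult_left_mono) auto
    also have "\<dots> = ereal (ln K / real (d i) + c)" using elim(1) by (simp add: field_simps)
    finally show ?case .
  qed
  then have "growth d a \<le> limsup (\<lambda>i. ereal (ln K / real (d i) + c))" by (rule Limsup_mono)
  also have "\<dots> = ereal c"
  proof (rule lim_imp_Limsup)
    have "(\<lambda>i. ln K / real (d i)) \<longlonglongrightarrow> 0"
      by (rule tendsto_divide_0[OF tendsto_const filterlim_at_top_imp_at_infinity])
        (rule filterlim_compose[OF filterlim_real_sequentially d])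
    then show "(\<lambda>i. ereal (ln K / real (d i) + c)) \<longlonglongrightarrow> ereal c"
      using tendsto_add[OF _ tendsto_const, of "\<lambda>i. ln K / real (d i)" 0 sequentially c] by simp
  qed simp
  finally show ?thesis .
qed

section \<open>The variational principle\<close>

text \<open>Members of a cover that miss the maps counted on the left are dropped. Each remaining
  one contains a map along which \<open>f\<close> has average above
  \<open>\<mu>(f) - \<epsilon>\<close>, so its supremum is at least the exponential factor;
  enlarging them to members of \<open>pow_cover\<close> compares their number with the covering
  number.\<close>

lemma cover_number_le_gen_N:
  fixes X :: "'x::metric_space set"
  assumes F: "F \<in> FinNE (carrier G)" and f: "f \<in> CX X" and \<epsilon>: "\<epsilon> \<le> \<delta>" and d: "0 < d"
  shows "cover_number (pow_cover \<U> d) (sofic_Map_measure X \<alpha> \<mu> d {f} F \<epsilon> \<sigma>)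
      * ennreal (exp (real d * ((\<integral>x. f x \<partial>\<mu>) - \<epsilon>))) \<le> gen_N \<A> X \<alpha> d \<sigma> F \<delta> \<U> f"
  unfolding gen_N_def
proof (rule INF_greatest, clarify)
  fix \<beta> assume \<beta>: "\<beta> \<subseteq> \<A> d" "sofic_Map X \<alpha> d F \<delta> \<sigma> \<subseteq> \<Union> \<beta>" "finer \<beta> (pow_cover \<U> d)"
  let ?M = "sofic_Map_measure X \<alpha> \<mu> d {f} F \<epsilon> \<sigma>"
  let ?e = "ennreal (exp (real d * ((\<integral>x. f x \<partial>\<mu>) - \<epsilon>)))"
  let ?S = "\<lambda>U. SUP \<phi>\<in>U \<inter> sofic_Map X \<alpha> d F \<delta> \<sigma>. ennreal (exp (\<Sum>a=1..d. f (\<phi> a)))"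
  define \<gamma> where "\<gamma> = {U \<in> \<beta>. U \<inter> ?M \<noteq> {}}"
  note M_iff = sofic_Map_measure_iff[OF F FinNE_singleton[OF f]]
  have M_sub: "?M \<subseteq> sofic_Map X \<alpha> d F \<delta> \<sigma>"
    unfolding M_iff sofic_Map_iff[OF F] subset_iff using \<epsilon> by (meson less_le_trans)
  have ge: "?e \<le> ?S U" if U: "U \<in> \<gamma>" for U
  proof -
    obtain \<phi> where \<phi>: "\<phi> \<in> U" "\<phi> \<in> ?M" using U by (auto simp: \<gamma>_def)
    then have "(\<integral>x. f x \<partial>\<mu>) - \<epsilon> \<le> 1 / real d * (\<Sum>j=1..d. f (\<phi> j))"
      unfolding M_iff by auto
    then have "real d * ((\<integral>x. f x \<partial>\<mu>) - \<epsilon>) \<le> (\<Sum>j=1..d. f (\<phi> j))"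
      using d by (simp add: field_simps)
    then have "?e \<le> ennreal (exp (\<Sum>j=1..d. f (\<phi> j)))" by (intro ennreal_leI) simp
    also have "\<dots> \<le> ?S U" using \<phi> M_sub by (intro SUP_upper) auto
    finally show ?thesis .
  qed
  have "cover_number (pow_cover \<U> d) ?M * ?e \<le> (\<Sum>\<^sub>\<infinity>U\<in>\<gamma>. ?S U)"
  proof (cases "finite \<gamma>")
    case True
    obtain V where V: "\<And>U. U \<in> \<beta> \<Longrightarrow> V U \<in> pow_cover \<U> d \<and> U \<subseteq> V U"
      using \<beta>(3) unfolding finer_def by metis
    have "?M \<subseteq> \<Union>\<gamma>" using M_sub \<beta>(2) by (fastforce simp: \<gamma>_def)
    then have "?M \<subseteq> \<Union>(V ` \<gamma>)" using V by (fastforce simp: \<gamma>_def)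
    then have "cover_number (pow_cover \<U> d) ?M \<le> of_nat (card (V ` \<gamma>))"
      unfolding cover_number_def using V True by (intro INF_lower) (auto simp: \<gamma>_def)
    also have "\<dots> \<le> of_nat (card \<gamma>)" using card_image_le[OF True] by simp
    finally have "cover_number (pow_cover \<U> d) ?M * ?e \<le> of_nat (card \<gamma>) * ?e"
      by (rule mult_right_mono) simp
    also have "\<dots> \<le> (\<Sum>U\<in>\<gamma>. ?S U)" using ge by (simp add: sum_bounded_below)
    finally show ?thesis using True by simp
  next
    \<comment> \<open>Infinitely many terms above one positive constant have an infinite
      sum.\<close>
    case False
    have "(\<Sum>\<^sub>\<infinity>U\<in>\<gamma>. ?S U) = \<infinity>"
      using infsum_superconst_infinite_ennreal[of \<gamma> ?e ?S] ge False by simp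
    then show ?thesis by simp
  qed
  also have "\<dots> \<le> (\<Sum>\<^sub>\<infinity>U\<in>\<beta>. ?S U)"
    by (rule infsum_mono_neutral) (auto simp: \<gamma>_def intro: nonneg_summable_on_complete)
  finally show "cover_number (pow_cover \<U> d) ?M * ?e \<le> (\<Sum>\<^sub>\<infinity>U\<in>\<beta>. ?S U)" .
qed

text \<open>\<open>\<A>\<close> is arbitrary, so one proof covers both \<open>P\<close> and
  \<open>P*\<close>. The entropy is tested with \<open>L = {f}\<close>, the given \<open>F\<close>
  and a tolerance \<open>\<epsilon>\<close>, which is the only loss in the exponent.\<close>

lemma measure_entropy_le_gen_P:
  assumes d: "filterlim d at_top sequentially" and f: "f \<in> CX X"
  shows "measure_entropy G X \<alpha> d \<sigma> \<mu> \<U> + ereal (\<integral>x. f x \<partial>\<mu>) \<le> gen_P \<A> G X \<alpha> d \<sigma> \<U> f"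
  unfolding gen_P_def
proof (intro INF_greatest)
  fix F and \<delta> :: real assume F: "F \<in> FinNE (carrier G)" and \<delta>: "\<delta> \<in> {0<..}"
  define m where "m = (\<integral>x. f x \<partial>\<mu>)"
  let ?h = "measure_entropy G X \<alpha> d \<sigma> \<mu> \<U>"
  \<comment> \<open>An arbitrary \<open>y\<close> above the pressure replaces a possibly infinite
    limsup by a real \<open>c\<close>; infinite \<open>y\<close> are trivial.\<close>
  have "?h + ereal m \<le> y" if y: "gen_P_at \<A> X \<alpha> d \<sigma> F \<delta> \<U> f < y" for y
  proof (cases y)
    case (real c)
    show ?thesis
      unfolding real
    proof (rule ereal_le_epsilon2)
      fix e :: real assume e: "0 < e"
      \<comment> \<open>At most \<open>\<delta>\<close>, so that the maps lie in
        \<open>Map(F, \<delta>)\<close>; at most \<open>e\<close>, to bound the loss.\<close>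
      define \<epsilon> where "\<epsilon> = min e \<delta>"
      have \<epsilon>: "0 < \<epsilon>" "\<epsilon> \<le> \<delta>" "\<epsilon> \<le> e" using e \<delta> by (auto simp: \<epsilon>_def)
      have "\<forall>\<^sub>F i in sequentially. 0 < d i" using d eventually_gt_at_top filterlim_iff by blast
      moreover have "\<forall>\<^sub>F i in sequentially. gen_N \<A> X \<alpha> (d i) (\<sigma> i) F \<delta> \<U> f < ennreal (exp (real (d i) * c))"
        using y real unfolding gen_P_at_def by (intro growth_lessD[OF d]) simp
      ultimately have "\<forall>\<^sub>F i in sequentially. cover_number (pow_cover \<U> (d i))
          (sofic_Map_measure X \<alpha> \<mu> (d i) {f} F \<epsilon> (\<sigma> i)) \<le> ennreal (1 * exp (real (d i) * (c - m + \<epsilon>)))"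
      proof eventually_elim
        case (elim i)
        let ?n = "cover_number (pow_cover \<U> (d i)) (sofic_Map_measure X \<alpha> \<mu> (d i) {f} F \<epsilon> (\<sigma> i))"
        have "?n * ennreal (exp (real (d i) * (m - \<epsilon>))) \<le> ennreal (exp (real (d i) * c))"
          using cover_number_le_gen_N[OF F f \<epsilon>(2) elim(1), of \<U> \<alpha> \<mu> "\<sigma> i" \<A>] elim(2)
          unfolding m_def by (meson less_imp_le order_trans)
        then have "?n * ennreal (exp (real (d i) * (m - \<epsilon>))) * ennreal (exp (- (real (d i) * (m - \<epsilon>))))
            \<le> ennreal (exp (real (d i) * c)) * ennreal (exp (- (real (d i) * (m - \<epsilon>))))"
          by (rule mult_right_mono) simp
        moreover have "ennreal (exp (real (d i) * c)) * ennreal (exp (- (real (d i) * (m - \<epsilon>))))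
            = ennreal (1 * exp (real (d i) * (c - m + \<epsilon>)))"
          by (simp add: ennreal_mult[symmetric] exp_add[symmetric] algebra_simps)
        moreover have "ennreal (exp (real (d i) * (m - \<epsilon>))) * ennreal (exp (- (real (d i) * (m - \<epsilon>)))) = 1"
          by (simp add: ennreal_mult[symmetric] exp_add[symmetric])
        ultimately show ?case by (simp add: mult.assoc)
      qed
      then have "measure_entropy_at X \<alpha> d \<sigma> \<mu> {f} F \<epsilon> \<U> \<le> ereal (c - m + \<epsilon>)"
        unfolding measure_entropy_at_def by (rule growth_leI[OF d zero_less_one])
      moreover have "?h \<le> measure_entropy_at X \<alpha> d \<sigma> \<mu> {f} F \<epsilon> \<U>"
        unfolding measure_entropy_def
        by (intro INF_lower2[OF FinNE_singleton[OF f]] INF_lower2[OF F] INF_lower2[of \<epsilon>]) (use \<epsilon> in auto)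
      ultimately have "?h \<le> ereal (c - m + \<epsilon>)" by (rule order_trans[rotated])
      then have "?h + ereal m \<le> ereal (c - m + \<epsilon>) + ereal m" by (rule add_right_mono)
      also have "\<dots> \<le> ereal c + ereal e" using \<epsilon> by simp
      finally show "?h + ereal m \<le> ereal c + ereal e" .
    qed
  qed (use y in auto)
  then show "?h + ereal (\<integral>x. f x \<partial>\<mu>) \<le> gen_P_at \<A> X \<alpha> d \<sigma> F \<delta> \<U> f"
    unfolding m_def by (rule dense_ge)
qed

section \<open>Upper bound for the pressure: local estimates, open covers, compactness\<close>

lemma measure_entropy_at_mono:
  assumes "L \<in> FinNE C" "L' \<in> FinNE C" "L \<subseteq> L'" "F \<in> FinNE S" "\<delta>' \<le> \<delta>"
  shows "measure_entropy_at X \<alpha> d \<sigma> \<mu> L' F \<delta>' \<U> \<le> measure_entropy_at X \<alpha> d \<sigma> \<mu> L F \<delta> \<U>"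
  unfolding measure_entropy_at_def
proof (rule growth_mono)
  fix i
  have "sofic_Map_measure X \<alpha> \<mu> (d i) L' F \<delta>' (\<sigma> i) \<subseteq> sofic_Map_measure X \<alpha> \<mu> (d i) L F \<delta> (\<sigma> i)"
    using assms(3)
    unfolding subset_iff sofic_Map_measure_iff[OF assms(4,1)] sofic_Map_measure_iff[OF assms(4,2)]
    by (meson less_le_trans[OF _ assms(5)])
  then show "cover_number (pow_cover \<U> (d i)) (sofic_Map_measure X \<alpha> \<mu> (d i) L' F \<delta>' (\<sigma> i))
      \<le> cover_number (pow_cover \<U> (d i)) (sofic_Map_measure X \<alpha> \<mu> (d i) L F \<delta> (\<sigma> i))"
    unfolding cover_number_def by (intro INF_superset_mono) auto
qed

text \<open>This supplies the weak* neighbourhood of each measure. Having \<open>f\<close> in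
  \<open>L\<close> caps the averages of \<open>f\<close> at \<open>\<mu>(f) + \<delta>\<close>, and
  that slack is already included in the estimate.\<close>

lemma entropy_below:
  fixes p :: ereal
  assumes d: "filterlim d at_top sequentially" and perm: "\<And>i s. s \<in> carrier G \<Longrightarrow> \<sigma> i s permutes {1..d i}"
    and X: "compact X" and act: "continuous_action G X \<alpha>" and f: "f \<in> CX X"
    and \<mu>: "\<mu> \<in> prob_measures X" and p: "p \<noteq> -\<infinity>"
    and less: "\<mu> \<in> invariant_measures G X \<alpha> \<Longrightarrow>
      measure_entropy G X \<alpha> d \<sigma> \<mu> \<U> + ereal (\<integral>x. f x \<partial>\<mu>) < p"
  shows "\<exists>L F \<delta>. L \<in> FinNE (CX X) \<and> F \<in> FinNE (carrier G) \<and> 0 < \<delta> \<and> f \<in> L \<and>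
    measure_entropy_at X \<alpha> d \<sigma> \<mu> L F \<delta> \<U> + ereal ((\<integral>x. f x \<partial>\<mu>) + \<delta>) < p"
proof -
  define m where "m = (\<integral>x. f x \<partial>\<mu>)"
  obtain L F \<delta> c where L: "L \<in> FinNE (CX X)" and F: "F \<in> FinNE (carrier G)" and \<delta>: "0 < \<delta>"
    and c: "measure_entropy_at X \<alpha> d \<sigma> \<mu> L F \<delta> \<U> \<le> ereal (c - m)" "ereal c < p"
  proof (cases "\<mu> \<in> invariant_measures G X \<alpha>")
    case True
    obtain c where c: "measure_entropy G X \<alpha> d \<sigma> \<mu> \<U> + ereal m < ereal c" "ereal c < p"
      using ereal_dense2[OF less[OF True]] by (auto simp: m_def)
    then have "measure_entropy G X \<alpha> d \<sigma> \<mu> \<U> < ereal (c - m)"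
      by (cases "measure_entropy G X \<alpha> d \<sigma> \<mu> \<U>") auto
    then obtain L F \<delta> where "L \<in> FinNE (CX X)" "F \<in> FinNE (carrier G)" "0 < \<delta>"
      "measure_entropy_at X \<alpha> d \<sigma> \<mu> L F \<delta> \<U> < ereal (c - m)"
      unfolding measure_entropy_def INF_less_iff by auto
    then show ?thesis using c by (intro that[of L F \<delta> c]) auto
  next
    case False
    obtain L F \<delta> where *: "L \<in> FinNE (CX X)" "F \<in> FinNE (carrier G)" "0 < \<delta>"
      "\<And>n \<tau>. 0 < n \<Longrightarrow> (\<forall>s\<in>carrier G. \<tau> s permutes {1..n}) \<Longrightarrow> sofic_Map_measure X \<alpha> \<mu> n L F \<delta> \<tau> = {}"
      using sofic_Map_measure_empty[OF X act \<mu> False] by metis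
    \<comment> \<open>Without maps the covering number is eventually 0, so any real \<open>c\<close>
      below \<open>p\<close> will do; one exists as \<open>p\<close> is not
      \<open>-\<infinity>\<close>.\<close>
    obtain c where c: "ereal c < p"
      using p ereal_dense2[of "-\<infinity>" p] by auto
    have "\<forall>\<^sub>F i in sequentially. 0 < d i" using d eventually_gt_at_top filterlim_iff by blast
    then have "\<forall>\<^sub>F i in sequentially. cover_number (pow_cover \<U> (d i))
        (sofic_Map_measure X \<alpha> \<mu> (d i) L F \<delta> (\<sigma> i)) \<le> ennreal (1 * exp (real (d i) * (c - m)))"
    proof eventually_elim
      case (elim i)
      have "cover_number (pow_cover \<U> (d i)) {} \<le> of_nat (card {})"
        unfolding cover_number_def by (rule INF_lower2[of "{}"]) auto
      then show ?case using *(4)[of "d i" "\<sigma> i"] elim perm by simp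
    qed
    then have "measure_entropy_at X \<alpha> d \<sigma> \<mu> L F \<delta> \<U> \<le> ereal (c - m)"
      unfolding measure_entropy_at_def by (rule growth_leI[OF d zero_less_one])
    then show ?thesis using * c by (intro that[of L F \<delta> c]) auto
  qed
  \<comment> \<open>The gap between \<open>c\<close> and \<open>c'\<close> pays for the extra
    \<open>\<delta>'\<close>; adding \<open>f\<close> to \<open>L\<close> and shrinking
    \<open>\<delta>\<close> only lowers the entropy term.\<close>
  obtain c' where c': "ereal c < ereal c'" "ereal c' < p" using ereal_dense2[OF c(2)] by blast
  define \<delta>' where "\<delta>' = min \<delta> (c' - c)"
  have \<delta>': "0 < \<delta>'" "\<delta>' \<le> \<delta>" "\<delta>' \<le> c' - c" using \<delta> c' by (auto simp: \<delta>'_def)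
  have "measure_entropy_at X \<alpha> d \<sigma> \<mu> (insert f L) F \<delta>' \<U> \<le> measure_entropy_at X \<alpha> d \<sigma> \<mu> L F \<delta> \<U>"
    using measure_entropy_at_mono[OF L FinNE_insert[OF f L] subset_insertI F \<delta>'(2)] .
  also note c(1)
  finally have "measure_entropy_at X \<alpha> d \<sigma> \<mu> (insert f L) F \<delta>' \<U> + ereal (m + \<delta>')
      \<le> ereal (c - m) + ereal (m + \<delta>')"
    by (rule add_right_mono)
  also have "\<dots> \<le> ereal c'" using \<delta>' by simp
  also note c'(2)
  finally show ?thesis using FinNE_insert[OF f L] F \<delta>'(1) unfolding m_def by blast
qed

lemma openin_average_less:
  assumes "f \<in> CX X"
  shows "openin (pow_topology X n) {\<phi> \<in> pow_space X n. (\<Sum>a=1..n. f (\<phi> a)) < c}"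
proof -
  have "continuous_map (pow_topology X n) euclideanreal (\<lambda>\<phi>. f (\<phi> a))" if "a \<in> {1..n}" for a
  proof -
    have "continuous_map (pow_topology X n) (top_of_set X) (\<lambda>\<phi>. \<phi> a)"
      unfolding pow_topology_def using that by (intro continuous_map_product_projection)
    moreover have "continuous_map (top_of_set X) euclideanreal f" using assms by (simp add: CX_def)
    ultimately have "continuous_map (pow_topology X n) euclideanreal (f \<circ> (\<lambda>\<phi>. \<phi> a))"
      by (rule continuous_map_compose)
    then show ?thesis by (simp add: comp_def)
  qed
  then have "continuous_map (pow_topology X n) euclideanreal (\<lambda>\<phi>. \<Sum>a=1..n. f (\<phi> a))"
    by (intro continuous_map_sum) auto
  from openin_continuous_map_preimage[OF this, of "{..<c}"]
  show ?thesis by (simp add: pow_topology_def pow_space_def PiE_def)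
qed

lemma openin_pow_cover:
  assumes "open_cover X \<U>" "W \<in> pow_cover \<U> n"
  shows "openin (pow_topology X n) W"
  using assms unfolding pow_cover_def pow_topology_def open_cover_def
  by (auto simp: openin_PiE_gen)

text \<open>Each member of \<open>\<W> v\<close> is intersected with the open set where the sum of
  \<open>f\<close> is below \<open>b v\<close>. The result stays open and finer than
  \<open>pow_cover\<close>, and its supremum is at most \<open>exp (b v)\<close>.\<close>

lemma gen_N_open_le:
  fixes X :: "'x::metric_space set" and \<W> :: "'t \<Rightarrow> (nat \<Rightarrow> 'x) set set"
  assumes cover: "open_cover X \<U>" and f: "f \<in> CX X" and n: "0 < n" and T: "finite T"
    and \<W>: "\<And>v. v \<in> T \<Longrightarrow> \<W> v \<subseteq> pow_cover \<U> n \<and> finite (\<W> v)"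
    and covers: "\<And>\<phi>. \<phi> \<in> sofic_Map X \<alpha> n F \<delta> \<sigma> \<Longrightarrow>
      \<exists>v\<in>T. \<phi> \<in> \<Union>(\<W> v) \<and> (\<Sum>a=1..n. f (\<phi> a)) < b v"
  shows "gen_N (\<lambda>n. {V. openin (pow_topology X n) V}) X \<alpha> n \<sigma> F \<delta> \<U> f
    \<le> (\<Sum>v\<in>T. of_nat (card (\<W> v)) * ennreal (exp (b v)))"
proof -
  let ?M = "sofic_Map X \<alpha> n F \<delta> \<sigma>"
  let ?S = "\<lambda>U. SUP \<phi>\<in>U \<inter> ?M. ennreal (exp (\<Sum>a=1..n. f (\<phi> a)))"
  define O' where "O' v = {\<phi> \<in> pow_space X n. (\<Sum>a=1..n. f (\<phi> a)) < b v}" for v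
  define \<beta> where "\<beta> = (\<lambda>(v, W). W \<inter> O' v) ` Sigma T \<W>"
  have fin: "finite (Sigma T \<W>)" using T \<W> by auto
  have "gen_N (\<lambda>n. {V. openin (pow_topology X n) V}) X \<alpha> n \<sigma> F \<delta> \<U> f \<le> (\<Sum>\<^sub>\<infinity>U\<in>\<beta>. ?S U)"
    unfolding gen_N_def
  proof (rule INF_lower, intro CollectI conjI)
    show "\<beta> \<subseteq> {V. openin (pow_topology X n) V}"
      using \<W> openin_pow_cover[OF cover] openin_average_less[OF f]
      by (auto simp: \<beta>_def O'_def intro!: openin_Int)
    show "?M \<subseteq> \<Union>\<beta>"
    proof
      fix \<phi> assume \<phi>: "\<phi> \<in> ?M"
      then obtain v W where "v \<in> T" "W \<in> \<W> v" "\<phi> \<in> W" "(\<Sum>a=1..n. f (\<phi> a)) < b v"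
        using covers by blast
      then show "\<phi> \<in> \<Union>\<beta>" using \<phi> by (auto simp: \<beta>_def O'_def sofic_Map_def)
    qed
    show "finer \<beta> (pow_cover \<U> n)" using \<W> by (force simp: finer_def \<beta>_def)
  qed
  also have "\<dots> = (\<Sum>U\<in>\<beta>. ?S U)" using fin by (simp add: \<beta>_def)
  \<comment> \<open>Different pairs may give the same set, so the sum over the image is only bounded
    by the sum over pairs.\<close>
  also have "\<dots> \<le> (\<Sum>z\<in>Sigma T \<W>. ?S (case z of (v, W) \<Rightarrow> W \<inter> O' v))"
    unfolding \<beta>_def using sum_image_le[OF fin, of ?S] by (simp add: comp_def)
  also have "\<dots> \<le> (\<Sum>(v, W)\<in>Sigma T \<W>. ennreal (exp (b v)))"
    by (intro sum_mono) (auto simp: O'_def intro!: SUP_least ennreal_leI)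
  also have "\<dots> = (\<Sum>v\<in>T. \<Sum>W\<in>\<W> v. ennreal (exp (b v)))"
    using T \<W> by (subst sum.Sigma) auto
  finally show ?thesis by simp
qed

text \<open>Attainment comes for free: if each single measure falls strictly short of
  \<open>P*\<close>, compactness makes the gap uniform. The value \<open>-\<infinity>\<close> is
  excluded because there may then be no invariant measure.\<close>

lemma ex_invariant_measure:
  fixes G :: "('g, 'm) monoid_scheme" and X :: "'x::metric_space set"
  assumes G: "group G" and sofic: "sofic_approximation G d \<sigma>" and X: "compact X"
    and act: "continuous_action G X \<alpha>" and cover: "open_cover X \<U>" and f: "f \<in> CX X"
    and p: "sofic_pressure_star G X \<alpha> d \<sigma> \<U> f \<noteq> -\<infinity>"
  shows "\<exists>\<mu>\<in>invariant_measures G X \<alpha>. sofic_pressure_star G X \<alpha> d \<sigma> \<U> f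
    \<le> measure_entropy G X \<alpha> d \<sigma> \<mu> \<U> + ereal (\<integral>x. f x \<partial>\<mu>)"
proof (rule ccontr)
  let ?p = "sofic_pressure_star G X \<alpha> d \<sigma> \<U> f"
  assume "\<not> ?thesis"
  then have less: "measure_entropy G X \<alpha> d \<sigma> \<mu> \<U> + ereal (\<integral>x. f x \<partial>\<mu>) < ?p"
    if "\<mu> \<in> invariant_measures G X \<alpha>" for \<mu>
    using that by (meson linorder_not_le)
  have d: "filterlim d at_top sequentially" and perm: "\<And>i s. s \<in> carrier G \<Longrightarrow> \<sigma> i s permutes {1..d i}"
    using sofic by (auto simp: sofic_approximation_def)
  have "\<exists>\<mu>\<in>prob_measures X. \<forall>g\<in>CX X. (\<integral>x. g x \<partial>\<mu>) = v g" if "v \<in> states X" for v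
    using X that by (intro state.riesz) (simp add: state_def)
  then obtain \<mu> where \<mu>: "\<And>v. v \<in> states X \<Longrightarrow> \<mu> v \<in> prob_measures X"
      "\<And>v g. v \<in> states X \<Longrightarrow> g \<in> CX X \<Longrightarrow> (\<integral>x. g x \<partial>\<mu> v) = v g"
    by metis
  have "\<exists>L F \<delta>. L \<in> FinNE (CX X) \<and> F \<in> FinNE (carrier G) \<and> 0 < \<delta> \<and> f \<in> L \<and>
    measure_entropy_at X \<alpha> d \<sigma> (\<mu> v) L F \<delta> \<U> + ereal (v f + \<delta>) < ?p" if v: "v \<in> states X" for v
    using entropy_below[OF d perm X act f \<mu>(1)[OF v] p less] \<mu>(2)[OF v f] by simp
  then obtain L F \<delta> where
      L: "\<And>v. v \<in> states X \<Longrightarrow> L v \<in> FinNE (CX X)" "\<And>v. v \<in> states X \<Longrightarrow> f \<in> L v" and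
      F: "\<And>v. v \<in> states X \<Longrightarrow> F v \<in> FinNE (carrier G)" and
      \<delta>: "\<And>v. v \<in> states X \<Longrightarrow> 0 < \<delta> v" and
      h: "\<And>v. v \<in> states X \<Longrightarrow>
        measure_entropy_at X \<alpha> d \<sigma> (\<mu> v) (L v) (F v) (\<delta> v) \<U> + ereal (v f + \<delta> v) < ?p"
    by metis
  \<comment> \<open>For an empirical state, membership in \<open>N v\<close> is exactly the
    condition on averages in the definition of \<open>sofic_Map_measure\<close>.\<close>
  define N where "N v = (\<Inter>g\<in>L v. {w. \<bar>w g - v g\<bar> < \<delta> v})" for v :: "('x \<Rightarrow> real) \<Rightarrow> real"
  have Nopen: "open (N v)" if "v \<in> states X" for v
    unfolding N_def
    using L(1)[OF that] by (intro open_INT ballI open_Collect_less continuous_intros) (auto simp: FinNE_def)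
  have Nmem: "v \<in> N v" if "v \<in> states X" for v using \<delta>[OF that] by (simp add: N_def)
  obtain T where T: "T \<subseteq> states X" "finite T" "states X \<subseteq> (\<Union>v\<in>T. N v)"
    using compactE_image[OF compact_states[OF X], of "states X" N] Nopen Nmem by blast
  \<comment> \<open>With \<open>F0\<close> and \<open>\<delta>0\<close> a map satisfies the
    equivariance conditions of all \<open>v\<close> in \<open>T\<close> at once. The identity keeps
    \<open>F0\<close> nonempty even if \<open>T\<close> is empty.\<close>
  define F0 where "F0 = insert \<one>\<^bsub>G\<^esub> (\<Union>v\<in>T. F v)"
  have F0: "F0 \<in> FinNE (carrier G)"
    using F T G by (auto simp: F0_def FinNE_def group.is_monoid monoid.one_closed)
  define \<delta>0 where "\<delta>0 = Min (insert 1 (\<delta> ` T))"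
  have \<delta>0: "0 < \<delta>0" "\<And>v. v \<in> T \<Longrightarrow> \<delta>0 \<le> \<delta> v"
    using \<delta> T by (auto simp: \<delta>0_def)
  define k where "k v = measure_entropy_at X \<alpha> d \<sigma> (\<mu> v) (L v) (F v) (\<delta> v) \<U> + ereal (v f + \<delta> v)" for v
  \<comment> \<open>Inserting \<open>-\<infinity>\<close> lets \<open>Max\<close> exist for empty
    \<open>T\<close>; one real \<open>c\<close> then separates all the local rates from
    \<open>P*\<close>.\<close>
  have "\<forall>z\<in>insert (-\<infinity>) (k ` T). z < ?p" using h T(1) p by (auto simp: k_def)
  then have "Max (insert (-\<infinity>) (k ` T)) < ?p" using T(2) by simp
  then obtain c where c: "Max (insert (-\<infinity>) (k ` T)) < ereal c" "ereal c < ?p"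
    using ereal_dense2 by blast
  have hc: "measure_entropy_at X \<alpha> d \<sigma> (\<mu> v) (L v) (F v) (\<delta> v) \<U> < ereal (c - (v f + \<delta> v))" if "v \<in> T" for v
  proof -
    have "k v < ereal c" using c(1) T(2) that by simp
    then show ?thesis
      by (cases "measure_entropy_at X \<alpha> d \<sigma> (\<mu> v) (L v) (F v) (\<delta> v) \<U>") (auto simp: k_def)
  qed
  let ?Mv = "\<lambda>i v. sofic_Map_measure X \<alpha> (\<mu> v) (d i) (L v) (F v) (\<delta> v) (\<sigma> i)"
  have "\<forall>\<^sub>F i in sequentially. \<forall>v\<in>T. cover_number (pow_cover \<U> (d i)) (?Mv i v)
      < ennreal (exp (real (d i) * (c - (v f + \<delta> v))))"
    using T(2) hc growth_lessD[OF d] unfolding measure_entropy_at_def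
    by (intro eventually_ball_finite) auto
  moreover have "\<forall>\<^sub>F i in sequentially. 0 < d i" using d eventually_gt_at_top filterlim_iff by blast
  ultimately have "\<forall>\<^sub>F i in sequentially.
    gen_N (\<lambda>n. {V. openin (pow_topology X n) V}) X \<alpha> (d i) (\<sigma> i) F0 \<delta>0 \<U> f
      \<le> ennreal (real (card T + 1) * exp (real (d i) * c))"
  proof eventually_elim
    case (elim i)
    have "\<exists>W. W \<subseteq> pow_cover \<U> (d i) \<and> finite W \<and> ?Mv i v \<subseteq> \<Union>W \<and>
        of_nat (card W) < ennreal (exp (real (d i) * (c - (v f + \<delta> v))))" if "v \<in> T" for v
      using bspec[OF elim(1) that] unfolding cover_number_def INF_less_iff by blast
    then obtain \<W> where \<W>: "\<And>v. v \<in> T \<Longrightarrow> \<W> v \<subseteq> pow_cover \<U> (d i) \<and> finite (\<W> v) \<and> ?Mv i v \<subseteq> \<Union>(\<W> v) \<and>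
        of_nat (card (\<W> v)) < ennreal (exp (real (d i) * (c - (v f + \<delta> v))))"
      by metis
    have "gen_N (\<lambda>n. {V. openin (pow_topology X n) V}) X \<alpha> (d i) (\<sigma> i) F0 \<delta>0 \<U> f
        \<le> (\<Sum>v\<in>T. of_nat (card (\<W> v)) * ennreal (exp (real (d i) * (v f + \<delta> v))))"
    proof (rule gen_N_open_le[OF cover f elim(2) T(2)])
      show "\<W> v \<subseteq> pow_cover \<U> (d i) \<and> finite (\<W> v)" if "v \<in> T" for v using \<W>[OF that] by blast
      fix \<phi> assume "\<phi> \<in> sofic_Map X \<alpha> (d i) F0 \<delta>0 (\<sigma> i)"
      then have \<phi>: "\<phi> \<in> pow_space X (d i)" "\<forall>s\<in>F0. rho2 (d i) (\<phi> \<circ> \<sigma> i s) (\<alpha> s \<circ> \<phi>) < \<delta>0"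
        unfolding sofic_Map_iff[OF F0] by auto
      \<comment> \<open>The finitely many neighbourhoods cover all states, hence every map belongs
        to one of the local families.\<close>
      obtain v where v: "v \<in> T" "empirical X (d i) \<phi> \<in> N v"
        using empirical_state[OF \<phi>(1) elim(2)] T(3) by blast
      have vS: "v \<in> states X" using v T by blast
      have near: "\<bar>1 / real (d i) * (\<Sum>j=1..d i. g (\<phi> j)) - v g\<bar> < \<delta> v" if g: "g \<in> L v" for g
      proof -
        have "g \<in> CX X" using g L(1)[OF vS] by (auto simp: FinNE_def)
        then show ?thesis using v(2) g by (auto simp: N_def empirical_def)
      qed
      have "\<phi> \<in> ?Mv i v"
        unfolding sofic_Map_measure_iff[OF F[OF vS] L(1)[OF vS]]
      proof (intro conjI ballI)
        show "rho2 (d i) (\<phi> \<circ> \<sigma> i s) (\<alpha> s \<circ> \<phi>) < \<delta> v" if "s \<in> F v" for s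
          using \<phi>(2) that v(1) \<delta>0(2)[OF v(1)] by (force simp: F0_def)
        show "\<bar>1 / real (d i) * (\<Sum>j=1..d i. g (\<phi> j)) - (\<integral>x. g x \<partial>\<mu> v)\<bar> < \<delta> v" if g: "g \<in> L v" for g
        proof -
          have "g \<in> CX X" using g L(1)[OF vS] by (auto simp: FinNE_def)
          then show ?thesis using near[OF g] \<mu>(2)[OF vS] by simp
        qed
      qed (rule \<phi>(1))
      then have "\<phi> \<in> \<Union>(\<W> v)" using \<W>[OF v(1)] by blast
      moreover have "(\<Sum>a=1..d i. f (\<phi> a)) < real (d i) * (v f + \<delta> v)"
      proof -
        have "1 / real (d i) * (\<Sum>j=1..d i. f (\<phi> j)) < v f + \<delta> v" using near[OF L(2)[OF vS]] by linarith
        then show ?thesis using elim(2) by (simp add: field_simps)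
      qed
      ultimately show "\<exists>v\<in>T. \<phi> \<in> \<Union>(\<W> v) \<and> (\<Sum>a=1..d i. f (\<phi> a)) < real (d i) * (v f + \<delta> v)"
        using v(1) by blast
    qed
    \<comment> \<open>The exponents \<open>c - (v f + \<delta> v)\<close> and
      \<open>v f + \<delta> v\<close> add up to the same \<open>c\<close> for every
      \<open>v\<close>.\<close>
    also have "\<dots> \<le> (\<Sum>v\<in>T. ennreal (exp (real (d i) * c)))"
    proof (rule sum_mono)
      fix v assume "v \<in> T"
      then have "of_nat (card (\<W> v)) * ennreal (exp (real (d i) * (v f + \<delta> v)))
          \<le> ennreal (exp (real (d i) * (c - (v f + \<delta> v)))) * ennreal (exp (real (d i) * (v f + \<delta> v)))"
        using \<W>[OF \<open>v \<in> T\<close>] by (intro mult_right_mono less_imp_le) simp_all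
      also have "\<dots> = ennreal (exp (real (d i) * c))"
        by (simp add: ennreal_mult[symmetric] exp_add[symmetric] algebra_simps)
      finally show "of_nat (card (\<W> v)) * ennreal (exp (real (d i) * (v f + \<delta> v))) \<le> ennreal (exp (real (d i) * c))" .
    qed
    also have "\<dots> = ennreal (real (card T) * exp (real (d i) * c))"
      by (simp add: ennreal_mult flip: ennreal_of_nat_eq_real_of_nat)
    \<comment> \<open>The added 1 makes the factor positive for empty \<open>T\<close>, as
      \<open>growth_leI\<close> requires.\<close>
    also have "\<dots> \<le> ennreal (real (card T + 1) * exp (real (d i) * c))"
      by (intro ennreal_leI mult_right_mono) auto
    finally show ?case .
  qed
  then have "gen_P_at (\<lambda>n. {V. openin (pow_topology X n) V}) X \<alpha> d \<sigma> F0 \<delta>0 \<U> f \<le> ereal c"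
    unfolding gen_P_at_def by (intro growth_leI[OF d, of "real (card T + 1)"]) auto
  moreover have "?p \<le> gen_P_at (\<lambda>n. {V. openin (pow_topology X n) V}) X \<alpha> d \<sigma> F0 \<delta>0 \<U> f"
    unfolding sofic_pressure_star_def gen_P_def
    by (intro INF_lower2[OF F0] INF_lower2[of \<delta>0]) (use \<delta>0 in auto)
  ultimately show False using c(2) by (meson leD order_trans)
qed

section \<open>Combination of the bounds\<close>

lemma sofic_pressure_le_star: "sofic_pressure G X \<alpha> d \<sigma> \<U> f \<le> sofic_pressure_star G X \<alpha> d \<sigma> \<U> f"
  unfolding sofic_pressure_def sofic_pressure_star_def gen_P_def gen_P_at_def
proof (rule INF_mono', rule INF_mono', rule growth_mono)
  fix F \<delta> i
  have "V \<subseteq> pow_space X (d i)" if "openin (pow_topology X (d i)) V" for V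
    using openin_subset[OF that] by (simp add: pow_topology_def pow_space_def)
  then show "gen_N (\<lambda>n. Pow (pow_space X n)) X \<alpha> (d i) (\<sigma> i) F \<delta> \<U> f
      \<le> gen_N (\<lambda>n. {V. openin (pow_topology X n) V}) X \<alpha> (d i) (\<sigma> i) F \<delta> \<U> f"
    unfolding gen_N_def by (intro INF_superset_mono) auto
qed

theorem theorem3p1:
  fixes G :: "('g, 'm) monoid_scheme"
    and d :: "nat \<Rightarrow> nat"
    and \<sigma> :: "nat \<Rightarrow> 'g \<Rightarrow> nat \<Rightarrow> nat"
    and X :: "'x::metric_space set"
    and \<alpha> :: "'g \<Rightarrow> 'x \<Rightarrow> 'x"
    and \<U> :: "'x set set"
    and f :: "'x \<Rightarrow> real"
  assumes "group G"
    and "countable (carrier G)"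
    and "infinite (carrier G)"
    and "sofic_approximation G d \<sigma>"
    and "compact X"
    and "continuous_action G X \<alpha>"
    and "open_cover X \<U>"
    and "f \<in> CX X"
  shows "sofic_pressure G X \<alpha> d \<sigma> \<U> f = sofic_pressure_star G X \<alpha> d \<sigma> \<U> f
    \<and> is_maximum
        ((\<lambda>\<mu>. measure_entropy G X \<alpha> d \<sigma> \<mu> \<U> + ereal (\<integral>x. f x \<partial>\<mu>)) ` invariant_measures G X \<alpha>)
        (sofic_pressure_star G X \<alpha> d \<sigma> \<U> f)"
proof -
  let ?P = "sofic_pressure G X \<alpha> d \<sigma> \<U> f" and ?p = "sofic_pressure_star G X \<alpha> d \<sigma> \<U> f"
  let ?h = "\<lambda>\<mu>. measure_entropy G X \<alpha> d \<sigma> \<mu> \<U> + ereal (\<integral>x. f x \<partial>\<mu>)"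
  have d: "filterlim d at_top sequentially"
    using assms(4) by (simp add: sofic_approximation_def)
  have lower: "?h \<mu> \<le> ?P" "?h \<mu> \<le> ?p" for \<mu>
    unfolding sofic_pressure_def sofic_pressure_star_def
    by (rule measure_entropy_le_gen_P[OF d assms(8)])+
  have ex: "\<exists>\<mu>\<in>invariant_measures G X \<alpha>. ?p \<le> ?h \<mu>" if "?p \<noteq> -\<infinity>"
    using ex_invariant_measure[OF assms(1,4,5,6,7,8) that] .
  \<comment> \<open>The measure that bounds \<open>P*\<close> from above also bounds
    \<open>P\<close> from below.\<close>
  have "?p \<le> ?P"
  proof (cases "?p = -\<infinity>")
    case False
    then show ?thesis using ex lower(1) by (meson order_trans)
  qed simp
  then have "?P = ?p" using sofic_pressure_le_star by (rule antisym[rotated])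
  moreover have "is_maximum (?h ` invariant_measures G X \<alpha>) ?p"
  proof (cases "invariant_measures G X \<alpha> = {}")
    case True
    \<comment> \<open>Without invariant measures \<open>ex\<close> forces
      \<open>P* = -\<infinity>\<close>, the agreed maximum of the empty set.\<close>
    then show ?thesis using ex by (auto simp: is_maximum_def)
  next
    case False
    \<comment> \<open>If \<open>P* = -\<infinity>\<close>, any invariant measure serves.\<close>
    then obtain \<mu> where \<mu>: "\<mu> \<in> invariant_measures G X \<alpha>" "?p \<le> ?h \<mu>"
      using ex by (cases "?p = -\<infinity>") auto
    have "?p = ?h \<mu>" using \<mu>(2) lower(2) by (rule antisym)
    then have "?p \<in> ?h ` invariant_measures G X \<alpha>" using \<mu>(1) by (rule image_eqI)
    then show ?thesis using False lower(2) by (auto simp: is_maximum_def)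
  qed
  ultimately show ?thesis by blast
qed

end
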